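(* Let $\alpha,\theta$ be nonconstant inner functions and let $D\in\mathcal{B}(K_\theta^\perp,K_\alpha^\perp)$. If $D$ is an asymmetric dual truncated Toeplitz operator, then $D$ is shift invariant, i.e. $$\langle D(zf),zg\rangle=\langle Df,g\rangle$$ for all $f\in K_\theta^\perp$ and $g\in K_\alpha^\perp$ such that $f$ and $g$ are orthogonal to the function $\bar z$.
   Context: $L^2=L^2(\mathbb{T},m)$ with $m$ normalized Lebesgue measure on the unit circle $\mathbb{T}$; $H^2\subset L^2$ is the Hardy space. For an inner function $\theta$, $K_\theta=H^2\ominus\theta H^2$ and $K_\theta^\perp=L^2\ominus K_\theta=\theta H^2\oplus\overline{zH^2}$. $P_\alpha^\perp$ is the orthogonal projection of $L^2$ onto $K_\alpha^\perp$. $\mathcal{B}(\mathcal{H},\mathcal{K})$ denotes bounded linear operators from $\mathcal{H}$ to $\mathcal{K}$. For $\varphi\in L^2$, $D^{\theta,\alpha}_\varphi$ is defined on $K_\theta^\perp\cap L^\infty$ (dense in $K_\theta^\perp$) by $D^{\theta,\alpha}_\varphi f=P_\alpha^\perp(\varphi f)$. If it extends to a bounded operator $K_\theta^\perp\to K_\alpha^\perp$ (this happens if and only if $\varphi\in L^\infty$), it is called an asymmetric dual truncated Toeplitz operator. An operator $A\in\mathcal{B}(\mathcal{K}_1,\mathcal{K}_2)$ between closed subspaces of $L^2$ is called shift invariant if $\langle A(zf),zg\rangle=\langle Af,g\rangle$ for all $f\in\mathcal{K}_1$, $g\in\mathcal{K}_2$ with $zf\in\mathcal{K}_1$ and $zg\in\mathcal{K}_2$.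 For $f\in K_\theta^\perp$ with $\theta$ nonconstant, $zf\in K_\theta^\perp$ if and only if $f\perp\bar z$. *)

theory Defs
  imports "HOL-Analysis.Analysis"
begin

text \<open>
  Elements of \<open>L\<^sup>2\<close> of the unit circle are represented by square-integrable functions;
  equality of such elements is almost everywhere equality, and the values of a
  function off the unit circle play no role.
\<close>

definition circle :: "complex measure" where
  "circle = distr (uniform_measure lborel {0..2 * pi}) (restrict_space borel (sphere 0 1)) cis"

definition L2 :: "(complex \<Rightarrow> complex) set" where
  "L2 = {f \<in> borel_measurable circle. integrable circle (\<lambda>z. (cmod (f z))\<^sup>2)}"

definition Linf :: "(complex \<Rightarrow> complex) set" where
  "Linf = {f \<in> borel_measurable circle. \<exists>C. AE z in circle. cmod (f z) \<le> C}"

definition l2_inner :: "(complex \<Rightarrow> complex) \<Rightarrow> (complex \<Rightarrow> complex) \<Rightarrow> complex" where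
  "l2_inner f g = (LINT z|circle. f z * cnj (g z))"

definition l2_norm :: "(complex \<Rightarrow> complex) \<Rightarrow> real" where
  "l2_norm f = sqrt (LINT z|circle. (cmod (f z))\<^sup>2)"

text \<open>The Hardy space, as the space of boundary functions: the negative Fourier coefficients vanish.\<close>

definition H2 :: "(complex \<Rightarrow> complex) set" where
  "H2 = {f \<in> L2. \<forall>n::int. n < 0 \<longrightarrow> l2_inner f (\<lambda>z. z powi n) = 0}"

text \<open>Inner functions are likewise given by their boundary values; \<open>H2 \<inter> Linf\<close> is \<open>H\<^sup>\<infinity>\<close>.\<close>

definition inner_function :: "(complex \<Rightarrow> complex) \<Rightarrow> bool" where
  "inner_function \<theta> \<longleftrightarrow> \<theta> \<in> H2 \<inter> Linf \<and> (AE z in circle. cmod (\<theta> z) = 1)"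

definition nonconstant :: "(complex \<Rightarrow> complex) \<Rightarrow> bool" where
  "nonconstant \<theta> \<longleftrightarrow> \<not> (\<exists>c. AE z in circle. \<theta> z = c)"

definition orth_diff ::
  "(complex \<Rightarrow> complex) set \<Rightarrow> (complex \<Rightarrow> complex) set \<Rightarrow> (complex \<Rightarrow> complex) set"
  (infixl "\<ominus>" 65) where
  "M \<ominus> N = {f \<in> M. \<forall>g\<in>N. l2_inner f g = 0}"

definition K :: "(complex \<Rightarrow> complex) \<Rightarrow> (complex \<Rightarrow> complex) set" where
  "K \<theta> = H2 \<ominus> (\<lambda>h z. \<theta> z * h z) ` H2"

definition K_perp :: "(complex \<Rightarrow> complex) \<Rightarrow> (complex \<Rightarrow> complex) set" where
  "K_perp \<theta> = L2 \<ominus> K \<theta>"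

text \<open>
  \<open>p\<close> represents the orthogonal projection of \<open>f\<close> onto \<open>M\<close>. This is a relation
  because \<open>p\<close> is determined only up to almost everywhere equality.
\<close>

definition is_orth_proj ::
  "(complex \<Rightarrow> complex) set \<Rightarrow> (complex \<Rightarrow> complex) \<Rightarrow> (complex \<Rightarrow> complex) \<Rightarrow> bool" where
  "is_orth_proj M f p \<longleftrightarrow> p \<in> M \<and> (\<forall>g\<in>M. l2_inner (\<lambda>z. f z - p z) g = 0)"

text \<open>
  Bounded (complex-)linear operators between subspaces of \<open>L\<^sup>2\<close>. Linearity is required
  almost everywhere; together with boundedness it makes \<open>D\<close> respect almost everywhere
  equality on \<open>M\<close>, so \<open>D\<close> induces an operator on equivalence classes.
\<close>

definition bounded_operator ::
  "(complex \<Rightarrow> complex) set \<Rightarrow> (complex \<Rightarrow> complex) set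
    \<Rightarrow> ((complex \<Rightarrow> complex) \<Rightarrow> (complex \<Rightarrow> complex)) \<Rightarrow> bool" where
  "bounded_operator M N D \<longleftrightarrow>
     (\<forall>f\<in>M. D f \<in> N) \<and>
     (\<forall>f\<in>M. \<forall>g\<in>M. AE z in circle. D (\<lambda>w. f w + g w) z = D f z + D g z) \<and>
     (\<forall>c. \<forall>f\<in>M. AE z in circle. D (\<lambda>w. c * f w) z = c * D f z) \<and>
     (\<exists>C. \<forall>f\<in>M. l2_norm (D f) \<le> C * l2_norm f)"

text \<open>
  Asymmetric dual truncated Toeplitz operators: \<open>D\<close> is a bounded extension of
  \<open>f \<mapsto> P\<^sub>\<alpha>\<^sup>\<bottom> (\<phi> f)\<close>, defined for bounded \<open>f\<close>, for some symbol \<open>\<phi>\<close> in \<open>L\<^sup>2\<close>.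
\<close>

definition ADTTO ::
  "(complex \<Rightarrow> complex) \<Rightarrow> (complex \<Rightarrow> complex)
    \<Rightarrow> ((complex \<Rightarrow> complex) \<Rightarrow> (complex \<Rightarrow> complex)) \<Rightarrow> bool" where
  "ADTTO \<theta> \<alpha> D \<longleftrightarrow>
     bounded_operator (K_perp \<theta>) (K_perp \<alpha>) D \<and>
     (\<exists>\<phi>\<in>L2. \<forall>f \<in> K_perp \<theta> \<inter> Linf. is_orth_proj (K_perp \<alpha>) (\<lambda>z. \<phi> z * f z) (D f))"

definition shift_invariant ::
  "(complex \<Rightarrow> complex) set \<Rightarrow> (complex \<Rightarrow> complex) set
    \<Rightarrow> ((complex \<Rightarrow> complex) \<Rightarrow> (complex \<Rightarrow> complex)) \<Rightarrow> bool" where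
  "shift_invariant M N D \<longleftrightarrow>
     (\<forall>f\<in>M. \<forall>g\<in>N. (\<lambda>z. z * f z) \<in> M \<longrightarrow> (\<lambda>z. z * g z) \<in> N \<longrightarrow>
        l2_inner (D (\<lambda>z. z * f z)) (\<lambda>z. z * g z) = l2_inner (D f) g)"

end

theory Submission
  imports Defs
begin

text \<open>
  On bounded functions the identity is a computation. If \<open>f\<close> and \<open>z f\<close> are bounded and in the
  complement of \<open>K \<theta>\<close>, and \<open>g\<close> and \<open>z g\<close> are in the complement of \<open>K \<alpha>\<close>, the projection in the
  definition of \<open>D\<close> can be dropped on both sides, and \<open>\<langle>\<phi> z f, z g\<rangle> = \<langle>\<phi> f, g\<rangle>\<close> because
  \<open>z * cnj z = 1\<close> on the circle (\<open>Toeplitz_shift_bounded\<close>). Both sides are continuous in \<open>f\<close>. So the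
  point is to approximate a given \<open>f\<close> by bounded functions \<open>s\<close> for which \<open>z s\<close> stays in the
  complement of \<open>K \<theta>\<close>, which is not clear from the density of bounded functions alone.

  The condition that \<open>z f\<close> be in the complement is equivalent to \<open>f\<close> being orthogonal to \<open>cnj z\<close>:
  one direction holds because the backward shift maps \<open>K \<theta>\<close> to itself (\<open>shift_mem_K_perp\<close>), the
  other because a nonconstant \<open>\<theta>\<close> gives a reproducing kernel at the origin that is not orthogonal
  to the constants (\<open>shift_mem_K_perp_imp_orthogonal\<close>). The functions \<open>\<theta> z\<^sup>n\<close> with \<open>n \<ge> 0\<close> and
  \<open>z\<^sup>n\<close> with \<open>n < -1\<close> are bounded, satisfy this condition, and have no nonzero common annihilator
  among the functions that satisfy it. By a Hilbert space argument, bounded functions are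
  therefore dense among them (\<open>bounded_dense_in_K_perp_orthogonal\<close>).

  The argument rests on completeness of \<open>L\<^sup>2\<close>, in the form that a subspace with trivial
  annihilator is dense (\<open>trivial_annihilator_imp_dense\<close>), and on uniqueness of Fourier coefficients
  (\<open>vanishing_moments_imp_AE_zero\<close>), which comes from the Stone-Weierstrass theorem. Together they
  show that a function orthogonal to the monomials \<open>z\<^sup>n\<close> with \<open>n \<ge> 0\<close> is orthogonal to \<open>H\<^sup>2\<close>, and so
  give the algebra needed here: \<open>H\<^sup>2\<close> is a module over \<open>H\<^sup>\<infinity>\<close> and evaluation at the origin is
  multiplicative.
\<close>

section \<open>The normalized measure on the circle\<close>

lemma borel_measurable_cnj [measurable]:
  assumes "f \<in> borel_measurable M"
  shows "(\<lambda>x. cnj (f x)) \<in> borel_measurable M"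
  using assms by (rule borel_measurable_continuous_on[OF continuous_on_cnj[OF continuous_on_id]])

lemma space_circle: "space circle = sphere 0 1"
  by (simp add: circle_def space_restrict_space)

lemma norm_on_circle: "z \<in> space circle \<Longrightarrow> cmod z = 1"
  by (simp add: space_circle)

lemma sets_circle: "sets circle = sets (restrict_space borel (sphere 0 1))"
  by (simp add: circle_def)

lemma cis_measurable_circle:
  "cis \<in> measurable (uniform_measure lborel {0..2 * pi}) (restrict_space borel (sphere 0 1))"
proof -
  have "cis \<in> borel_measurable borel"
    by (intro borel_measurable_continuous_onI continuous_intros)
  then show ?thesis
    by (intro measurable_restrict_space2) (auto simp: measurable_def)
qed

lemma finite_measure_circle: "finite_measure circle"
proof -
  have "emeasure (uniform_measure lborel {0..2 * pi}) UNIV \<noteq> \<infinity>"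
    by (subst emeasure_uniform_measure) (auto simp: ennreal_divide_eq_top_iff)
  then have "finite_measure (uniform_measure lborel {0..2 * pi})"
    by (intro finite_measureI) simp
  then show ?thesis
    unfolding circle_def by (intro finite_measure.finite_measure_distr cis_measurable_circle)
qed

interpretation circle: finite_measure circle
  by (rule finite_measure_circle)

lemma measurable_circle_continuous:
  "continuous_on (sphere 0 1) f \<Longrightarrow> f \<in> borel_measurable circle"
  using borel_measurable_continuous_on_restrict measurable_cong_sets[OF sets_circle refl] by blast

lemma measurable_circle_powi [measurable]: "(\<lambda>z. z powi n) \<in> borel_measurable circle"
  by (intro measurable_circle_continuous continuous_intros) auto

lemma integral_circle:
  fixes f :: "complex \<Rightarrow> complex"
  assumes "continuous_on (sphere 0 1) f"
  shows "(LINT z|circle. f z) = (LINT t|lborel. indicator {0..2*pi} t *\<^sub>R f (cis t)) / (2 * pi)"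
proof -
  have m: "f \<in> borel_measurable (restrict_space borel (sphere 0 1))"
    using assms by (rule borel_measurable_continuous_on_restrict)
  have fc: "(\<lambda>t. f (cis t)) \<in> borel_measurable borel"
    by (intro borel_measurable_continuous_onI continuous_on_compose2[OF assms] continuous_intros) auto
  have e: "uniform_measure lborel {0..2*pi} =
      density lborel (\<lambda>t. ennreal (indicator {0..2*pi} t / (2*pi)))"
    unfolding uniform_measure_def
    by (intro density_cong) (auto simp: indicator_def divide_ennreal[symmetric])
  have "(LINT z|circle. f z) = (LINT t|uniform_measure lborel {0..2*pi}. f (cis t))"
    unfolding circle_def by (rule integral_distr[OF cis_measurable_circle m])
  also have "\<dots> = (LINT t|lborel. (indicator {0..2*pi} t / (2*pi)) *\<^sub>R f (cis t))"
    unfolding e using fc by (intro integral_density) auto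
  also have "\<dots> = (LINT t|lborel. (indicator {0..2*pi} t *\<^sub>R f (cis t)) / (2*pi))"
    by (intro Bochner_Integration.integral_cong) (auto simp: scaleR_conv_of_real)
  finally show ?thesis by simp
qed

lemma integral_circle_powi: "(LINT z|circle. z powi n) = (if n = 0 then 1 else 0)"
proof -
  have e: "cis t powi n = cis (of_int n * t)" for t
    by (simp add: cis_power_int)
  have "(LINT z|circle. z powi n) = (LINT t|lborel. indicator {0..2*pi} t *\<^sub>R cis (of_int n * t)) / (2*pi)"
    by (subst integral_circle) (auto intro!: continuous_intros simp: e)
  also have "\<dots> = (if n = 0 then 1 else 0)"
  proof (cases "n = 0")
    case True
    have "(LINT t|lborel. indicator {0..2*pi} t *\<^sub>R (1::complex)) = of_real (2*pi) - of_real 0"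
      by (intro integral_FTC_Icc) (auto intro!: derivative_eq_intros)
    then show ?thesis using True by simp
  next
    case False
    define F where "F t = cis (of_int n * t) / (\<i> * of_int n)" for t :: real
    have F_exp: "F = (\<lambda>t. (\<lambda>w. exp (\<i> * (of_int n * w)) / (\<i> * of_int n)) (of_real t))"
      by (simp add: fun_eq_iff F_def cis_conv_exp)
    have "(F has_vector_derivative cis (of_int n * t)) (at t within X)" for t X
      unfolding F_exp using False
      by (intro has_vector_derivative_real_field) (auto intro!: derivative_eq_intros simp: cis_conv_exp algebra_simps)
    then have "(LINT t|lborel. indicator {0..2*pi} t *\<^sub>R cis (of_int n * t)) = F (2*pi) - F 0"
      by (intro integral_FTC_Icc) (auto intro!: continuous_intros)
    also have "F (2*pi) = F 0"
      using cis_multiple_2pi[of "of_int n"] by (simp add: F_def mult_ac)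
    finally show ?thesis using False by simp
  qed
  finally show ?thesis .
qed

section \<open>Elementary geometry of \<open>L\<^sup>2\<close>\<close>

lemma L2_measurable: "f \<in> L2 \<Longrightarrow> f \<in> borel_measurable circle"
  by (simp add: L2_def)

lemma L2_square_integrable: "f \<in> L2 \<Longrightarrow> integrable circle (\<lambda>z. (cmod (f z))\<^sup>2)"
  by (simp add: L2_def)

lemma L2_integrable_mult_cnj:
  assumes "f \<in> L2" "g \<in> L2"
  shows "integrable circle (\<lambda>z. f z * cnj (g z))"
proof (rule Bochner_Integration.integrable_bound)
  note [measurable] = assms[THEN L2_measurable]
  show "integrable circle (\<lambda>z. (cmod (f z))\<^sup>2 + (cmod (g z))\<^sup>2)"
    using assms by (simp add: L2_square_integrable)
  show "(\<lambda>z. f z * cnj (g z)) \<in> borel_measurable circle" by measurable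
  have "x * y \<le> x\<^sup>2 + y\<^sup>2" if "x \<ge> 0" "y \<ge> 0" for x y :: real
    using sum_squares_bound[of x y] that mult_nonneg_nonneg[OF that] by linarith
  then show "AE z in circle. norm (f z * cnj (g z)) \<le> norm ((cmod (f z))\<^sup>2 + (cmod (g z))\<^sup>2)"
    by (auto simp: norm_mult)
qed

lemma L2_add [intro]:
  assumes "f \<in> L2" "g \<in> L2"
  shows "(\<lambda>z. f z + g z) \<in> L2"
proof -
  note [measurable] = assms[THEN L2_measurable]
  have "integrable circle (\<lambda>z. (cmod (f z + g z))\<^sup>2)"
  proof (rule Bochner_Integration.integrable_bound)
    show "integrable circle (\<lambda>z. 2 * ((cmod (f z))\<^sup>2 + (cmod (g z))\<^sup>2))"
      using assms by (simp add: L2_square_integrable)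
    show "(\<lambda>z. (cmod (f z + g z))\<^sup>2) \<in> borel_measurable circle" by measurable
    have "(cmod (x + y))\<^sup>2 \<le> 2 * ((cmod x)\<^sup>2 + (cmod y)\<^sup>2)" for x y
    proof -
      have "(cmod (x + y))\<^sup>2 \<le> (cmod x + cmod y)\<^sup>2"
        by (simp add: norm_triangle_ineq power_mono)
      then show ?thesis
        using sum_squares_bound[of "cmod x" "cmod y"] by (simp add: power2_sum)
    qed
    then show "AE z in circle. norm ((cmod (f z + g z))\<^sup>2) \<le> norm (2 * ((cmod (f z))\<^sup>2 + (cmod (g z))\<^sup>2))"
      by auto
  qed
  then show ?thesis by (simp add: L2_def)
qed

lemma Linf_mult_L2 [intro]:
  assumes "a \<in> Linf" "f \<in> L2"
  shows "(\<lambda>z. a z * f z) \<in> L2"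
proof -
  obtain C where [measurable]: "a \<in> borel_measurable circle" and C: "AE z in circle. cmod (a z) \<le> C"
    using assms(1) by (auto simp: Linf_def)
  note [measurable] = L2_measurable[OF assms(2)]
  have "integrable circle (\<lambda>z. (cmod (a z * f z))\<^sup>2)"
  proof (rule Bochner_Integration.integrable_bound)
    show "integrable circle (\<lambda>z. C\<^sup>2 * (cmod (f z))\<^sup>2)"
      using assms by (simp add: L2_square_integrable)
    show "(\<lambda>z. (cmod (a z * f z))\<^sup>2) \<in> borel_measurable circle" by measurable
    show "AE z in circle. norm ((cmod (a z * f z))\<^sup>2) \<le> norm (C\<^sup>2 * (cmod (f z))\<^sup>2)"
      using C by eventually_elim (auto simp: norm_mult power_mult_distrib intro!: mult_right_mono power_mono)
  qed
  then show ?thesis by (simp add: L2_def)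
qed

lemma Linf_const [intro, simp]: "(\<lambda>z. c) \<in> Linf"
  by (auto simp: Linf_def)

lemma L2_scale [intro]: "f \<in> L2 \<Longrightarrow> (\<lambda>z. c * f z) \<in> L2"
  by (rule Linf_mult_L2[OF Linf_const])

lemma L2_diff [intro]: "f \<in> L2 \<Longrightarrow> g \<in> L2 \<Longrightarrow> (\<lambda>z. f z - g z) \<in> L2"
  using L2_add[of f "\<lambda>z. (-1) * g z"] L2_scale[of g "-1"] by simp

lemma Linf_subset_L2: "Linf \<subseteq> L2"
proof
  fix f assume "f \<in> Linf"
  moreover have "(\<lambda>z. 1) \<in> L2" by (simp add: L2_def)
  ultimately have "(\<lambda>z. f z * 1) \<in> L2" by (rule Linf_mult_L2)
  then show "f \<in> L2" by simp
qed

lemma Linf_powi [intro, simp]: "(\<lambda>z. z powi n) \<in> Linf"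
  by (auto simp: Linf_def norm_power_int norm_on_circle intro!: exI[of _ 1] AE_I2)

lemma Linf_ident [intro, simp]: "(\<lambda>z. z) \<in> Linf"
  using Linf_powi[of 1] by simp

lemma Linf_mult [intro]:
  assumes "f \<in> Linf" "g \<in> Linf"
  shows "(\<lambda>z. f z * g z) \<in> Linf"
proof -
  obtain A B where [measurable]: "f \<in> borel_measurable circle" "g \<in> borel_measurable circle"
    and A: "AE z in circle. cmod (f z) \<le> A" and B: "AE z in circle. cmod (g z) \<le> B"
    using assms by (auto simp: Linf_def)
  have "AE z in circle. cmod (f z * g z) \<le> A * B"
    using A B by eventually_elim (auto simp: norm_mult intro!: mult_mono order.trans[OF norm_ge_zero])
  then show ?thesis by (auto simp: Linf_def)
qed

lemma Linf_add [intro]: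
  assumes "f \<in> Linf" "g \<in> Linf"
  shows "(\<lambda>z. f z + g z) \<in> Linf"
proof -
  obtain A B where [measurable]: "f \<in> borel_measurable circle" "g \<in> borel_measurable circle"
    and A: "AE z in circle. cmod (f z) \<le> A" and B: "AE z in circle. cmod (g z) \<le> B"
    using assms by (auto simp: Linf_def)
  have "AE z in circle. cmod (f z + g z) \<le> A + B"
    using A B by eventually_elim (meson add_mono norm_triangle_le)
  then show ?thesis by (auto simp: Linf_def)
qed

lemma Linf_cnj [intro]: "f \<in> Linf \<Longrightarrow> (\<lambda>z. cnj (f z)) \<in> Linf"
  by (auto simp: Linf_def)

lemma L2_powi [intro, simp]: "(\<lambda>z. z powi n) \<in> L2"
  using Linf_subset_L2 Linf_powi by blast

lemma L2_const [intro, simp]: "(\<lambda>z. c) \<in> L2"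
  using Linf_subset_L2 Linf_const by blast

lemma l2_inner_add_left:
  "f \<in> L2 \<Longrightarrow> g \<in> L2 \<Longrightarrow> h \<in> L2 \<Longrightarrow> l2_inner (\<lambda>z. f z + g z) h = l2_inner f h + l2_inner g h"
  by (simp add: l2_inner_def distrib_right L2_integrable_mult_cnj)

lemma l2_inner_diff_left:
  "f \<in> L2 \<Longrightarrow> g \<in> L2 \<Longrightarrow> h \<in> L2 \<Longrightarrow> l2_inner (\<lambda>z. f z - g z) h = l2_inner f h - l2_inner g h"
  by (simp add: l2_inner_def left_diff_distrib L2_integrable_mult_cnj)

lemma l2_inner_scale_left: "l2_inner (\<lambda>z. c * f z) g = c * l2_inner f g"
  by (simp add: l2_inner_def mult.assoc)

lemma l2_inner_commute: "l2_inner f g = cnj (l2_inner g f)"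
  unfolding l2_inner_def by (subst Bochner_Integration.integral_cnj[symmetric]) (simp add: mult.commute)

lemma l2_inner_eq_0_commute: "l2_inner f g = 0 \<longleftrightarrow> l2_inner g f = 0"
  by (metis complex_cnj_zero l2_inner_commute)

lemma l2_inner_cong_AE:
  assumes "AE z in circle. f z * cnj (g z) = f' z * cnj (g' z)"
    and "f \<in> L2" "g \<in> L2" "f' \<in> L2" "g' \<in> L2"
  shows "l2_inner f g = l2_inner f' g'"
  unfolding l2_inner_def
  by (intro integral_cong_AE borel_measurable_integrable L2_integrable_mult_cnj assms)

lemma l2_inner_cong:
  "(\<And>z. z \<in> space circle \<Longrightarrow> f z * cnj (g z) = f' z * cnj (g' z)) \<Longrightarrow> l2_inner f g = l2_inner f' g'"
  unfolding l2_inner_def by (intro Bochner_Integration.integral_cong) auto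

lemma l2_norm_nonneg [simp]: "l2_norm f \<ge> 0"
  by (simp add: l2_norm_def)

lemma l2_norm_square: "(l2_norm f)\<^sup>2 = (LINT z|circle. (cmod (f z))\<^sup>2)"
  by (simp add: l2_norm_def)

lemma l2_inner_self: "l2_inner f f = of_real ((l2_norm f)\<^sup>2)"
  unfolding l2_inner_def l2_norm_square complex_norm_square[symmetric] by (rule integral_complex_of_real)

lemma l2_norm_square_diff_scale:
  assumes f: "f \<in> L2" and g: "g \<in> L2"
  shows "(l2_norm (\<lambda>z. f z - c * g z))\<^sup>2 =
    (l2_norm f)\<^sup>2 - 2 * Re (cnj c * l2_inner f g) + (cmod c)\<^sup>2 * (l2_norm g)\<^sup>2"
proof -
  define q where "q z = Re (cnj c * (f z * cnj (g z)))" for z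
  have "(cmod (x - c * y))\<^sup>2 = (cmod x)\<^sup>2 - 2 * Re (cnj c * (x * cnj y)) + (cmod c)\<^sup>2 * (cmod y)\<^sup>2" for x y
    by (simp only: cmod_power2) (simp add: power2_eq_square algebra_simps)
  then have "(cmod (f z - c * g z))\<^sup>2 = (cmod (f z))\<^sup>2 - 2 * q z + (cmod c)\<^sup>2 * (cmod (g z))\<^sup>2" for z
    unfolding q_def .
  moreover have "Re (cnj c * l2_inner f g) = (LINT z|circle. q z)"
    unfolding l2_inner_def integral_mult_right_zero[symmetric] q_def
    using L2_integrable_mult_cnj[OF f g]
    by (intro integral_Re[symmetric] integrable_mult_right)
  moreover have "integrable circle q"
    unfolding q_def using L2_integrable_mult_cnj[OF f g]
    by (intro integrable_Re integrable_mult_right)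
  ultimately show ?thesis
    unfolding l2_norm_square using L2_square_integrable[OF f] L2_square_integrable[OF g] by simp
qed

text \<open>
  The discriminant argument behind the Cauchy-Schwarz inequality, with a slack \<open>A\<close> in place of
  a squared norm: the minimum of the quadratic is attained at \<open>c = w / B\<close>.
\<close>

lemma quadratic_nonneg_imp_discriminant:
  fixes A B :: real
  assumes nonneg: "\<And>c. 0 \<le> A - 2 * Re (cnj c * w) + (cmod c)\<^sup>2 * B" and "B \<ge> 0"
  shows "(cmod w)\<^sup>2 \<le> A * B"
proof (cases "B = 0")
  case True
  have sq: "Re (cnj (of_real t * w) * w) = t * (cmod w)\<^sup>2" for t
    by (simp only: cmod_power2) (simp add: power2_eq_square algebra_simps)
  have "cmod w = 0"
  proof (rule ccontr)
    assume nz: "cmod w \<noteq> 0"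
    have "0 \<le> A - 2 * ((A + 1) / (2 * (cmod w)\<^sup>2) * (cmod w)\<^sup>2)"
      using nonneg[of "of_real ((A + 1) / (2 * (cmod w)\<^sup>2)) * w"] True by (simp only: sq)
    then show False using nz by simp
  qed
  then show ?thesis using True by simp
next
  case False
  then have B: "B > 0" using assms(2) by simp
  have sq: "cnj w * w = of_real ((cmod w)\<^sup>2)"
    by (simp add: mult.commute complex_norm_square del: of_real_power)
  have "0 \<le> A - 2 * ((cmod w)\<^sup>2 / B) + (cmod w / B)\<^sup>2 * B"
    using nonneg[of "w / of_real B"] B by (simp add: sq norm_divide del: of_real_power)
  also have "\<dots> = A - (cmod w)\<^sup>2 / B"
    using B by (simp add: field_simps power2_eq_square)
  finally show ?thesis using B by (simp add: field_simps)
qed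

lemma l2_Cauchy_Schwarz:
  assumes "f \<in> L2" "g \<in> L2"
  shows "cmod (l2_inner f g) \<le> l2_norm f * l2_norm g"
proof -
  have "(cmod (l2_inner f g))\<^sup>2 \<le> (l2_norm f)\<^sup>2 * (l2_norm g)\<^sup>2"
  proof (rule quadratic_nonneg_imp_discriminant)
    fix c
    show "0 \<le> (l2_norm f)\<^sup>2 - 2 * Re (cnj c * l2_inner f g) + (cmod c)\<^sup>2 * (l2_norm g)\<^sup>2"
      unfolding l2_norm_square_diff_scale[OF assms, symmetric] by (rule zero_le_power2)
  qed (rule zero_le_power2)
  then show ?thesis
    by - (rule power2_le_imp_le, simp_all add: power_mult_distrib)
qed

lemma l2_norm_triangle:
  assumes "f \<in> L2" "g \<in> L2"
  shows "l2_norm (\<lambda>z. f z + g z) \<le> l2_norm f + l2_norm g"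
proof (rule power2_le_imp_le)
  have "(l2_norm (\<lambda>z. f z + g z))\<^sup>2 = (l2_norm f)\<^sup>2 + 2 * Re (l2_inner f g) + (l2_norm g)\<^sup>2"
    using l2_norm_square_diff_scale[OF assms, of "-1"] by simp
  also have "Re (l2_inner f g) \<le> l2_norm f * l2_norm g"
    using l2_Cauchy_Schwarz[OF assms] complex_Re_le_cmod order.trans by blast
  finally show "(l2_norm (\<lambda>z. f z + g z))\<^sup>2 \<le> (l2_norm f + l2_norm g)\<^sup>2"
    by (simp add: power2_sum)
qed simp

lemma l2_norm_eq_0_imp_AE:
  assumes "f \<in> L2" "l2_norm f = 0"
  shows "AE z in circle. f z = 0"
proof -
  have "(LINT z|circle. (cmod (f z))\<^sup>2) = 0"
    using assms(2) l2_norm_square[of f] by simp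
  then show ?thesis
    using integral_nonneg_eq_0_iff_AE[OF L2_square_integrable[OF assms(1)]] by simp
qed

lemma l2_norm_cong_AE:
  assumes "AE z in circle. cmod (f z) = cmod (g z)" "f \<in> L2" "g \<in> L2"
  shows "l2_norm f = l2_norm g"
proof -
  have "AE z in circle. (cmod (f z))\<^sup>2 = (cmod (g z))\<^sup>2"
    using assms(1) by eventually_elim simp
  then show ?thesis
    unfolding l2_norm_def using assms(2,3)
    by (intro arg_cong[of _ _ sqrt] integral_cong_AE borel_measurable_integrable L2_square_integrable)
qed

lemma cnj_eq_inverse_of_norm_1:
  fixes w :: complex
  assumes "cmod w = 1"
  shows "cnj w = inverse w"
proof -
  have "w * cnj w = 1" using assms complex_norm_square[of w] by simp
  then show ?thesis by (rule inverse_unique[symmetric])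
qed

lemma cnj_powi_on_circle:
  assumes "z \<in> space circle"
  shows "cnj z powi n = z powi (-n)"
  using assms by (simp add: cnj_eq_inverse_of_norm_1 norm_on_circle power_int_minus power_int_inverse)

lemma l2_inner_powi_powi: "l2_inner (\<lambda>z. z powi m) (\<lambda>z. z powi n) = (if m = n then 1 else 0)"
proof -
  have "z powi m * cnj (z powi n) = z powi (m - n)" if "z \<in> space circle" for z
  proof -
    have "z \<noteq> 0" using norm_on_circle[OF that] by auto
    then show ?thesis
      using power_int_add[of z m "-n"] by (simp add: cnj_powi_on_circle[OF that])
  qed
  then have "(LINT z|circle. z powi m * cnj (z powi n)) = (LINT z|circle. z powi (m - n))"
    by (intro Bochner_Integration.integral_cong) auto
  then show ?thesis
    unfolding l2_inner_def by (simp add: integral_circle_powi)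
qed

lemma l2_norm_scale: "l2_norm (\<lambda>z. c * f z) = cmod c * l2_norm f"
  by (simp add: l2_norm_def norm_mult power_mult_distrib real_sqrt_mult)

lemma l2_parallelogram:
  assumes "f \<in> L2" "g \<in> L2"
  shows "(l2_norm (\<lambda>z. f z - g z))\<^sup>2 + (l2_norm (\<lambda>z. f z + g z))\<^sup>2 =
    2 * (l2_norm f)\<^sup>2 + 2 * (l2_norm g)\<^sup>2"
  using l2_norm_square_diff_scale[OF assms, of 1] l2_norm_square_diff_scale[OF assms, of "-1"]
  by simp

lemma L2_integrable_norm:
  assumes "f \<in> L2"
  shows "integrable circle (\<lambda>z. cmod (f z))"
    and "(LINT z|circle. cmod (f z)) \<le> l2_norm f * l2_norm (\<lambda>z. 1)"
proof -
  define g where "g = (\<lambda>z. complex_of_real (cmod (f z)))"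
  note [measurable] = L2_measurable[OF assms]
  have g: "g \<in> L2"
    using assms by (auto simp: L2_def g_def)
  show "integrable circle (\<lambda>z. cmod (f z))"
    using L2_integrable_mult_cnj[OF assms L2_const[of 1]] by simp
  have "l2_inner g (\<lambda>z. 1) = of_real (LINT z|circle. cmod (f z))"
    by (simp add: l2_inner_def g_def)
  then have "(LINT z|circle. cmod (f z)) \<le> cmod (l2_inner g (\<lambda>z. 1))"
    by simp
  also have "\<dots> \<le> l2_norm g * l2_norm (\<lambda>z. 1)"
    by (rule l2_Cauchy_Schwarz[OF g L2_const])
  also have "l2_norm g = l2_norm f"
    by (simp add: l2_norm_def g_def)
  finally show "(LINT z|circle. cmod (f z)) \<le> l2_norm f * l2_norm (\<lambda>z. 1)" .
qed

lemma l2_inner_tendsto_left: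
  assumes s: "\<And>n. s n \<in> L2" and "p \<in> L2" "t \<in> L2"
    and lim: "(\<lambda>n. l2_norm (\<lambda>z. s n z - p z)) \<longlonglongrightarrow> 0"
  shows "(\<lambda>n. l2_inner (s n) t) \<longlonglongrightarrow> l2_inner p t"
proof -
  have "(\<lambda>n. l2_norm (\<lambda>z. s n z - p z) * l2_norm t) \<longlonglongrightarrow> 0"
    using lim by (rule tendsto_mult_left_zero)
  moreover have "cmod (l2_inner (s n) t - l2_inner p t) \<le> l2_norm (\<lambda>z. s n z - p z) * l2_norm t" for n
    using l2_Cauchy_Schwarz[of "\<lambda>z. s n z - p z" t] assms
    by (simp add: l2_inner_diff_left L2_diff)
  ultimately have "(\<lambda>n. l2_inner (s n) t - l2_inner p t) \<longlonglongrightarrow> 0"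
    by - (rule Lim_null_comparison, auto)
  then show ?thesis by (simp add: LIM_zero_iff)
qed

section \<open>Completeness and a density criterion\<close>

text \<open>
  The increments of the sequence are summable in \<open>L\<^sup>1\<close>, hence absolutely summable almost everywhere,
  which produces a pointwise limit; Fatou's lemma then bounds the \<open>L\<^sup>2\<close> distance to it. The
  geometric rate is harmless since the minimizing sequences used below can be chosen this fast.
\<close>

lemma L2_complete_geometric:
  assumes s: "\<And>n. s n \<in> L2"
    and fast: "\<And>n. l2_norm (\<lambda>z. s (Suc n) z - s n z) \<le> (1/2) ^ n"
  obtains p where "p \<in> L2" "(\<lambda>n. l2_norm (\<lambda>z. s n z - p z)) \<longlonglongrightarrow> 0"
proof -
  define d where "d = (\<lambda>n z. s (Suc n) z - s n z)"
  define M where "M = l2_norm (\<lambda>z. 1)"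
  define p where "p z = lim (\<lambda>n. s n z)" for z
  have d: "d n \<in> L2" for n
    unfolding d_def using s by (intro L2_diff)
  note [measurable] = L2_measurable[OF s] L2_measurable[OF d]
  have [measurable]: "p \<in> borel_measurable circle"
    unfolding p_def by measurable

  have nn: "(\<integral>\<^sup>+z. ennreal (cmod (d n z)) \<partial>circle) \<le> ennreal ((1/2) ^ n * M)" for n
  proof -
    have "(\<integral>\<^sup>+z. ennreal (cmod (d n z)) \<partial>circle) = ennreal (LINT z|circle. cmod (d n z))"
      using L2_integrable_norm(1)[OF d] by (intro nn_integral_eq_integral) auto
    also have "(LINT z|circle. cmod (d n z)) \<le> l2_norm (d n) * M"
      unfolding M_def by (rule L2_integrable_norm(2)[OF d])
    also have "\<dots> \<le> (1/2) ^ n * M"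
      using fast[of n] by (intro mult_right_mono) (auto simp: d_def M_def)
    finally show ?thesis by (simp add: ennreal_leI)
  qed
  have "(\<integral>\<^sup>+z. (\<Sum>n. ennreal (cmod (d n z))) \<partial>circle) = (\<Sum>n. \<integral>\<^sup>+z. ennreal (cmod (d n z)) \<partial>circle)"
    by (intro nn_integral_suminf) measurable
  also have "\<dots> \<le> (\<Sum>n. ennreal ((1/2) ^ n * M))"
    by (intro suminf_le nn) auto
  also have "\<dots> = ennreal (\<Sum>n. (1/2) ^ n * M)"
    by (intro suminf_ennreal2 summable_mult2 summable_geometric) (auto simp: M_def)
  finally have "(\<integral>\<^sup>+z. (\<Sum>n. ennreal (cmod (d n z))) \<partial>circle) \<noteq> \<infinity>"
    by (auto simp: top_unique)
  then have "AE z in circle. (\<Sum>n. ennreal (cmod (d n z))) \<noteq> \<infinity>"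
    by (intro nn_integral_PInf_AE) measurable
  then have ptw: "AE z in circle. (\<lambda>n. s n z) \<longlonglongrightarrow> p z"
  proof eventually_elim
    case (elim z)
    have "summable (\<lambda>n. cmod (d n z))"
      using elim by (intro summable_suminf_not_top) auto
    then have "summable (\<lambda>n. d n z)"
      by (rule summable_norm_cancel)
    then have "convergent (\<lambda>n. s 0 z + (\<Sum>k<n. d k z))"
      by (intro convergent_add convergent_const) (simp add: summable_iff_convergent)
    moreover have "s 0 z + (\<Sum>k<n. d k z) = s n z" for n
      unfolding d_def by (simp add: sum_lessThan_telescope[of "\<lambda>k. s k z"])
    ultimately show ?case
      unfolding p_def by (simp add: convergent_LIMSEQ_iff)
  qed

  have tail: "l2_norm (\<lambda>z. s (n + k) z - s n z) \<le> 2 * (1/2) ^ n - 2 * (1/2) ^ (n + k)" for n k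
  proof (induction k)
    case 0
    then show ?case by (simp add: l2_norm_def)
  next
    case (Suc k)
    have "l2_norm (\<lambda>z. s (n + Suc k) z - s n z) = l2_norm (\<lambda>z. d (n + k) z + (s (n + k) z - s n z))"
      by (simp add: d_def)
    also have "\<dots> \<le> l2_norm (d (n + k)) + l2_norm (\<lambda>z. s (n + k) z - s n z)"
      using d s by (intro l2_norm_triangle L2_diff)
    also have "\<dots> \<le> (1/2) ^ (n + k) + (2 * (1/2) ^ n - 2 * (1/2) ^ (n + k))"
      using Suc.IH fast[of "n + k"] by (intro add_mono) (auto simp: d_def)
    finally show ?case by simp
  qed

  have fatou: "integrable circle (\<lambda>z. (cmod (s n z - p z))\<^sup>2) \<and> l2_norm (\<lambda>z. s n z - p z) \<le> 2 * (1/2) ^ n" for n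
  proof -
    let ?C = "(2 * (1/2) ^ n)\<^sup>2 :: real"
    have "(\<integral>\<^sup>+z. ennreal ((cmod (s n z - p z))\<^sup>2) \<partial>circle)
        = (\<integral>\<^sup>+z. liminf (\<lambda>k. ennreal ((cmod (s (n + k) z - s n z))\<^sup>2)) \<partial>circle)"
    proof (intro nn_integral_cong_AE, use ptw in eventually_elim)
      case (elim z)
      have "(\<lambda>k. s (n + k) z) \<longlonglongrightarrow> p z"
        using LIMSEQ_ignore_initial_segment[OF elim, of n] by (simp add: add.commute)
      then have "(\<lambda>k. ennreal ((cmod (s (n + k) z - s n z))\<^sup>2)) \<longlonglongrightarrow> ennreal ((cmod (p z - s n z))\<^sup>2)"
        by (intro tendsto_intros)
      then have "liminf (\<lambda>k. ennreal ((cmod (s (n + k) z - s n z))\<^sup>2)) = ennreal ((cmod (p z - s n z))\<^sup>2)"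
        by (intro lim_imp_Liminf) auto
      then show ?case
        by (simp only: norm_minus_commute)
    qed
    also have "\<dots> \<le> liminf (\<lambda>k. \<integral>\<^sup>+z. ennreal ((cmod (s (n + k) z - s n z))\<^sup>2) \<partial>circle)"
      by (intro nn_integral_liminf) measurable
    also have "\<dots> \<le> liminf (\<lambda>k::nat. ennreal ?C)"
    proof (intro Liminf_mono always_eventually allI)
      fix k
      have "(\<integral>\<^sup>+z. ennreal ((cmod (s (n + k) z - s n z))\<^sup>2) \<partial>circle)
          = ennreal ((l2_norm (\<lambda>z. s (n + k) z - s n z))\<^sup>2)"
        unfolding l2_norm_square using s by (intro nn_integral_eq_integral L2_square_integrable L2_diff) auto
      also have "l2_norm (\<lambda>z. s (n + k) z - s n z) \<le> 2 * (1/2) ^ n"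
        using tail[of n k] by (rule order.trans) simp
      then have "ennreal ((l2_norm (\<lambda>z. s (n + k) z - s n z))\<^sup>2) \<le> ennreal ?C"
        by (intro ennreal_leI power_mono) auto
      finally show "(\<integral>\<^sup>+z. ennreal ((cmod (s (n + k) z - s n z))\<^sup>2) \<partial>circle) \<le> ennreal ?C" .
    qed
    also have "\<dots> = ennreal ?C"
      by (simp add: Liminf_const)
    finally have le: "(\<integral>\<^sup>+z. ennreal ((cmod (s n z - p z))\<^sup>2) \<partial>circle) \<le> ennreal ?C" .
    then have int: "integrable circle (\<lambda>z. (cmod (s n z - p z))\<^sup>2)"
      by (intro integrableI_bounded) (auto intro: le_less_trans)
    have "ennreal ((l2_norm (\<lambda>z. s n z - p z))\<^sup>2) \<le> ennreal ?C"
      using le nn_integral_eq_integral[OF int] by (simp add: l2_norm_square)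
    then have "(l2_norm (\<lambda>z. s n z - p z))\<^sup>2 \<le> ?C"
      by (subst (asm) ennreal_le_iff) auto
    then have "l2_norm (\<lambda>z. s n z - p z) \<le> 2 * (1/2) ^ n"
      by (rule power2_le_imp_le) simp
    with int show ?thesis by simp
  qed
  have "(\<lambda>z. s 0 z - p z) \<in> L2"
    using fatou[of 0] by (simp add: L2_def)
  from L2_diff[OF s[of 0] this] have "p \<in> L2" by simp
  moreover have "(\<lambda>n. 2 * (1/2) ^ n :: real) \<longlonglongrightarrow> 0"
    by (intro tendsto_mult_right_zero LIMSEQ_power_zero) simp
  then have "(\<lambda>n. l2_norm (\<lambda>z. s n z - p z)) \<longlonglongrightarrow> 0"
    by (rule Lim_null_comparison[rotated]) (use fatou in auto)
  ultimately show ?thesis by (rule that)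
qed

text \<open>
  The Hilbert space fact that a subspace is dense in a closed subspace as soon as its annihilator
  there is zero. Closed subspaces appear as orthogonal complements \<open>L2 \<ominus> X\<close>, which makes
  closedness automatic. The nearest point \<open>p\<close> to \<open>f\<close> in the closure of \<open>S\<close> is the limit of a
  minimizing sequence, Cauchy by the parallelogram law; \<open>f - p\<close> annihilates \<open>S\<close> and so vanishes.
\<close>

lemma trivial_annihilator_imp_dense:
  assumes X: "X \<subseteq> L2" and S: "S \<subseteq> L2 \<ominus> X" and ne: "S \<noteq> {}"
    and add: "\<And>s t. s \<in> S \<Longrightarrow> t \<in> S \<Longrightarrow> (\<lambda>z. s z + t z) \<in> S"
    and scale: "\<And>c s. s \<in> S \<Longrightarrow> (\<lambda>z. c * s z) \<in> S"
    and annihilator: "\<And>u. u \<in> L2 \<ominus> X \<Longrightarrow> (\<forall>s\<in>S. l2_inner u s = 0) \<Longrightarrow> AE z in circle. u z = 0"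
    and f: "f \<in> L2 \<ominus> X" and "e > 0"
  obtains s where "s \<in> S" "l2_norm (\<lambda>z. f z - s z) < e"
proof -
  have fL: "f \<in> L2" and SL: "\<And>s. s \<in> S \<Longrightarrow> s \<in> L2"
    using f S by (auto simp: orth_diff_def)
  define d where "d = (INF s\<in>S. (l2_norm (\<lambda>z. f z - s z))\<^sup>2)"
  have d_le: "d \<le> (l2_norm (\<lambda>z. f z - s z))\<^sup>2" if "s \<in> S" for s
    unfolding d_def using that by (intro cINF_lower bdd_belowI2[of _ 0]) auto
  (* the quarter makes consecutive terms of the minimizing sequence 2^-n-close *)
  define \<epsilon> :: "nat \<Rightarrow> real" where "\<epsilon> n = (1/4) ^ n / 4" for n
  have "\<exists>s\<in>S. (l2_norm (\<lambda>z. f z - s z))\<^sup>2 < d + \<epsilon> n" for n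
  proof -
    have "d < d + \<epsilon> n" by (simp add: \<epsilon>_def)
    then have "Inf ((\<lambda>s. (l2_norm (\<lambda>z. f z - s z))\<^sup>2) ` S) < d + \<epsilon> n"
      unfolding d_def[symmetric] .
    from cInf_lessD[OF _ this] ne show ?thesis by auto
  qed
  then obtain s where sS: "\<And>n. s n \<in> S" and near: "\<And>n. (l2_norm (\<lambda>z. f z - s n z))\<^sup>2 < d + \<epsilon> n"
    by metis
  note sL = SL[OF sS]

  have fast: "l2_norm (\<lambda>z. s (Suc n) z - s n z) \<le> (1/2) ^ n" for n
  proof (rule power2_le_imp_le)
    define a b where "a = (\<lambda>z. f z - s n z)" and "b = (\<lambda>z. f z - s (Suc n) z)"
    define m where "m = (\<lambda>z. (1/2) * (s n z + s (Suc n) z))"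
    have ab: "a \<in> L2" "b \<in> L2"
      unfolding a_def b_def using fL sL by (auto intro!: L2_diff)
    have "m \<in> S" unfolding m_def by (intro scale add sS)
    have "(\<lambda>z. a z + b z) = (\<lambda>z. 2 * (f z - m z))"
      by (auto simp: a_def b_def m_def algebra_simps)
    then have sum: "(l2_norm (\<lambda>z. a z + b z))\<^sup>2 = 4 * (l2_norm (\<lambda>z. f z - m z))\<^sup>2"
      by (simp only: l2_norm_scale) (simp add: power_mult_distrib)
    have diff: "(\<lambda>z. a z - b z) = (\<lambda>z. s (Suc n) z - s n z)"
      by (auto simp: a_def b_def)
    have "(l2_norm (\<lambda>z. s (Suc n) z - s n z))\<^sup>2 \<le> 2 * (d + \<epsilon> n) + 2 * (d + \<epsilon> (Suc n)) - 4 * d"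
      using l2_parallelogram[OF ab] d_le[OF \<open>m \<in> S\<close>] near[of n] near[of "Suc n"]
      unfolding sum diff a_def[symmetric] b_def[symmetric] by argo
    also have "\<dots> \<le> (1/4) ^ n"
      by (simp add: \<epsilon>_def field_simps)
    also have "\<dots> = ((1/2) ^ n)\<^sup>2"
      by (simp add: power2_eq_square flip: power_mult_distrib)
    finally show "(l2_norm (\<lambda>z. s (Suc n) z - s n z))\<^sup>2 \<le> ((1/2) ^ n)\<^sup>2" .
  qed simp
  obtain p where p: "p \<in> L2" and lim: "(\<lambda>n. l2_norm (\<lambda>z. s n z - p z)) \<longlonglongrightarrow> 0"
    by (rule L2_complete_geometric[OF sL fast])
  have "l2_inner p x = 0" if "x \<in> X" for x
  proof -
    have "(\<lambda>n. l2_inner (s n) x) \<longlonglongrightarrow> l2_inner p x"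
      using X that by (intro l2_inner_tendsto_left sL p lim) auto
    moreover have "l2_inner (s n) x = 0" for n
      using S sS that by (auto simp: orth_diff_def)
    ultimately show ?thesis by (simp add: LIMSEQ_const_iff)
  qed
  then have "(\<lambda>z. f z - p z) \<in> L2 \<ominus> X"
    using f p X by (auto simp: orth_diff_def l2_inner_diff_left subset_iff)
  moreover have "l2_inner (\<lambda>z. f z - p z) t = 0" if t: "t \<in> S" for t
  proof -
    have tL: "t \<in> L2" using SL[OF t] .
    have le: "(cmod (l2_inner (\<lambda>z. f z - s n z) t))\<^sup>2 \<le> \<epsilon> n * (l2_norm t)\<^sup>2" for n
    proof (rule quadratic_nonneg_imp_discriminant)
      fix c
      have "(\<lambda>z. s n z + c * t z) \<in> S" by (intro add scale sS t)
      from d_le[OF this] near[of n]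
      show "0 \<le> \<epsilon> n - 2 * Re (cnj c * l2_inner (\<lambda>z. f z - s n z) t) + (cmod c)\<^sup>2 * (l2_norm t)\<^sup>2"
        using l2_norm_square_diff_scale[OF L2_diff[OF fL sL] tL, of n c]
        by (simp add: diff_diff_eq)
    qed simp
    have "(\<lambda>n. l2_inner (s n) t) \<longlonglongrightarrow> l2_inner p t"
      by (intro l2_inner_tendsto_left sL p lim tL)
    then have "(\<lambda>n. (cmod (l2_inner (\<lambda>z. f z - s n z) t))\<^sup>2) \<longlonglongrightarrow> (cmod (l2_inner f t - l2_inner p t))\<^sup>2"
      by (simp add: l2_inner_diff_left fL sL tL) (intro tendsto_intros)
    moreover have "(\<lambda>n. \<epsilon> n * (l2_norm t)\<^sup>2) \<longlonglongrightarrow> 0"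
      unfolding \<epsilon>_def by (intro tendsto_mult_left_zero tendsto_divide_zero LIMSEQ_power_zero) simp
    ultimately have "(cmod (l2_inner f t - l2_inner p t))\<^sup>2 \<le> 0"
      by (rule LIMSEQ_le) (use le in auto)
    then show ?thesis by (simp add: l2_inner_diff_left fL p tL)
  qed
  ultimately have "AE z in circle. f z - p z = 0"
    using annihilator by blast
  then have "AE z in circle. cmod (f z - s n z) = cmod (s n z - p z)" for n
    by eventually_elim (simp add: norm_minus_commute)
  then have "l2_norm (\<lambda>z. f z - s n z) = l2_norm (\<lambda>z. s n z - p z)" for n
    by (rule l2_norm_cong_AE) (auto intro!: L2_diff fL sL p)
  moreover obtain n where "l2_norm (\<lambda>z. s n z - p z) < e"
    using order_tendstoD(2)[OF lim \<open>e > 0\<close>] by (auto simp: eventually_sequentially)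
  ultimately show ?thesis using that sS by metis
qed

section \<open>Uniqueness of Fourier coefficients\<close>

lemma integrable_mult_continuous_circle:
  fixes w f :: "complex \<Rightarrow> complex"
  assumes "integrable circle w" "continuous_on (sphere 0 1) f"
  shows "integrable circle (\<lambda>z. w z * f z)"
proof -
  have [measurable]: "f \<in> borel_measurable circle" "w \<in> borel_measurable circle"
    using assms by (auto intro: measurable_circle_continuous)
  have "bounded (f ` sphere 0 1)"
    using assms(2) by (intro compact_imp_bounded compact_continuous_image) auto
  then obtain C where C: "\<And>z. z \<in> sphere 0 1 \<Longrightarrow> cmod (f z) \<le> C"
    unfolding bounded_iff by blast
  show ?thesis
  proof (rule Bochner_Integration.integrable_bound)
    show "integrable circle (\<lambda>z. C * cmod (w z))"
      using assms(1) by simp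
    show "(\<lambda>z. w z * f z) \<in> borel_measurable circle" by measurable
    have "cmod (w z * f z) \<le> norm (C * cmod (w z))" if "z \<in> space circle" for z
    proof -
      have "cmod (w z * f z) \<le> C * cmod (w z)"
        using C[of z] that by (simp add: space_circle norm_mult mult.commute[of C] mult_left_mono)
      then show ?thesis by simp
    qed
    then show "AE z in circle. norm (w z * f z) \<le> norm (C * cmod (w z))"
      by (intro AE_I2)
  qed
qed

lemma continuous_on_real_polynomial_function:
  "real_polynomial_function p \<Longrightarrow> continuous_on S p"
  by (simp add: continuous_on_polymonial_function real_polynomial_function_eq)

text \<open>
  On the circle a real linear form is a combination of \<open>z\<close> and \<open>1 / z\<close>, so multiplying by it only
  mixes neighbouring moments. Quantifying over all functions \<open>w\<close> with vanishing moments makes the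
  property stable under products of polynomials.
\<close>

lemma vanishing_moments_mult_polynomial:
  assumes "real_polynomial_function p"
    and "integrable circle w" "\<And>n::int. (LINT z|circle. w z * z powi n) = 0"
  shows "(LINT z|circle. (w z * of_real (p z)) * z powi n) = 0"
  using assms
proof (induction arbitrary: w n rule: real_polynomial_function.induct)
  case (linear p)
  define a b where "a = (of_real (p 1) - \<i> * of_real (p \<i>)) / 2"
    and "b = (of_real (p 1) + \<i> * of_real (p \<i>)) / 2"
  have moment: "integrable circle (\<lambda>z. w z * z powi m)" for m
    using linear.prems(1)
    by (rule integrable_mult_continuous_circle) (auto intro!: continuous_intros)
  have "(w z * of_real (p z)) * z powi n = a * (w z * z powi (n + 1)) + b * (w z * z powi (n - 1))"
    if z: "z \<in> space circle" for z
  proof -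
    interpret p: bounded_linear p by fact
    have "z = Re z *\<^sub>R 1 + Im z *\<^sub>R \<i>"
      by (simp add: complex_eq_iff)
    then have "p z = Re z * p 1 + Im z * p \<i>"
      by (metis p.add p.scale real_scaleR_def)
    then have lin: "of_real (p z) = a * z + b * cnj z"
      by (simp add: a_def b_def complex_eq_iff field_simps)
    have nz: "z \<noteq> 0" using norm_on_circle[OF z] by auto
    have neighbours: "z * z powi n = z powi (n + 1)" "cnj z * z powi n = z powi (n - 1)"
      using nz cnj_powi_on_circle[OF z, of 1]
      by (simp_all add: power_int_add power_int_diff power_int_minus field_simps)
    have "(w z * of_real (p z)) * z powi n = a * (w z * (z * z powi n)) + b * (w z * (cnj z * z powi n))"
      by (simp add: lin algebra_simps)
    then show ?thesis
      by (simp only: neighbours)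
  qed
  then have "(LINT z|circle. (w z * of_real (p z)) * z powi n) =
      (LINT z|circle. a * (w z * z powi (n + 1)) + b * (w z * z powi (n - 1)))"
    by (intro Bochner_Integration.integral_cong) auto
  also have "\<dots> = 0"
    using moment linear.prems(2) by simp
  finally show ?case .
next
  case (const c)
  have "(LINT z|circle. (w z * of_real c) * z powi n) = (LINT z|circle. of_real c * (w z * z powi n))"
    by (intro Bochner_Integration.integral_cong) auto
  then show ?case using const.prems(2) by simp
next
  case (add p q)
  have cont: "continuous_on (sphere 0 1) p" "continuous_on (sphere 0 1) q"
    using add.hyps continuous_on_real_polynomial_function by auto
  have int: "integrable circle (\<lambda>z. (w z * of_real (r z)) * z powi n)"
    if "continuous_on (sphere 0 1) r" for r :: "complex \<Rightarrow> real"
    using that add.prems(1)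
    by (intro integrable_mult_continuous_circle) (auto intro!: continuous_intros)
  have "(LINT z|circle. (w z * of_real (p z + q z)) * z powi n) =
      (LINT z|circle. (w z * of_real (p z)) * z powi n + (w z * of_real (q z)) * z powi n)"
    by (intro Bochner_Integration.integral_cong) (auto simp: algebra_simps)
  also have "\<dots> = 0"
    using int[OF cont(1)] int[OF cont(2)] add.IH add.prems by simp
  finally show ?case .
next
  case (mult p q)
  have "continuous_on (sphere 0 1) p"
    using mult.hyps continuous_on_real_polynomial_function by auto
  then have "integrable circle (\<lambda>z. w z * of_real (p z))"
    using mult.prems(1) by (intro integrable_mult_continuous_circle) (auto intro!: continuous_intros)
  moreover have "(LINT z|circle. (w z * of_real (p z)) * z powi m) = 0" for m
    using mult.prems by (rule mult.IH(1))
  ultimately have "(LINT z|circle. ((w z * of_real (p z)) * of_real (q z)) * z powi n) = 0"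
    by (rule mult.IH(2))
  then show ?case by (simp add: mult.assoc)
qed

lemma vanishing_moments_mult_continuous:
  fixes g :: "complex \<Rightarrow> real"
  assumes w: "integrable circle w" and moments: "\<And>n::int. (LINT z|circle. w z * z powi n) = 0"
    and g: "continuous_on (sphere 0 1) g"
  shows "(LINT z|circle. w z * of_real (g z)) = 0"
proof -
  define I where "I = (LINT z|circle. cmod (w z))"
  have bound: "cmod (LINT z|circle. w z * of_real (g z)) \<le> e * I" if "e > 0" for e
  proof -
    obtain p where p: "real_polynomial_function p" and close: "\<And>z. z \<in> sphere 0 1 \<Longrightarrow> \<bar>g z - p z\<bar> < e"
      using Stone_Weierstrass_real_polynomial_function[OF _ g \<open>e > 0\<close>] by auto
    have int: "integrable circle (\<lambda>z. w z * of_real (r z))"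
      if "continuous_on (sphere 0 1) r" for r :: "complex \<Rightarrow> real"
      using that w by (intro integrable_mult_continuous_circle) (auto intro!: continuous_intros)
    have pc: "continuous_on (sphere 0 1) p"
      using p by (rule continuous_on_real_polynomial_function)
    have "(LINT z|circle. w z * of_real (p z)) = 0"
      using vanishing_moments_mult_polynomial[OF p w moments, of 0] by simp
    then have "(LINT z|circle. w z * of_real (g z)) = (LINT z|circle. w z * of_real (g z) - w z * of_real (p z))"
      using int[OF g] int[OF pc] by simp
    also have "cmod \<dots> \<le> (LINT z|circle. cmod (w z * of_real (g z) - w z * of_real (p z)))"
      by (rule integral_norm_bound)
    also have "\<dots> \<le> (LINT z|circle. e * cmod (w z))"
    proof (rule integral_mono)
      show "integrable circle (\<lambda>z. cmod (w z * of_real (g z) - w z * of_real (p z)))"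
        using int[OF g] int[OF pc] by auto
      show "integrable circle (\<lambda>z. e * cmod (w z))"
        using w by simp
      fix z assume z: "z \<in> space circle"
      have "w z * of_real (g z) - w z * of_real (p z) = w z * of_real (g z - p z)"
        by (simp add: algebra_simps)
      then have "cmod (w z * of_real (g z) - w z * of_real (p z)) = cmod (w z) * \<bar>g z - p z\<bar>"
        by (simp only: norm_mult norm_of_real)
      also have "\<dots> \<le> cmod (w z) * e"
        using close[of z] z by (intro mult_left_mono) (auto simp: space_circle)
      finally show "cmod (w z * of_real (g z) - w z * of_real (p z)) \<le> e * cmod (w z)"
        by (simp add: mult.commute)
    qed
    finally show ?thesis by (simp add: I_def)
  qed
  have "cmod (LINT z|circle. w z * of_real (g z)) \<le> 0"
  proof (rule field_le_epsilon)
    fix e :: real assume "e > 0"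
    have "I \<ge> 0" by (simp add: I_def)
    have "cmod (LINT z|circle. w z * of_real (g z)) \<le> e / (I + 1) * I"
      using \<open>e > 0\<close> \<open>I \<ge> 0\<close> by (intro bound) simp
    also have "\<dots> \<le> 0 + e"
      using \<open>e > 0\<close> \<open>I \<ge> 0\<close> by (simp add: field_simps)
    finally show "cmod (LINT z|circle. w z * of_real (g z)) \<le> 0 + e" .
  qed
  then show ?thesis by simp
qed

text \<open>Indicators of closed sets are bounded pointwise limits of continuous functions.\<close>

lemma vanishing_moments_integral_closed:
  assumes w: "integrable circle w" and moments: "\<And>n::int. (LINT z|circle. w z * z powi n) = 0"
    and F: "closed F"
  shows "(LINT z|circle. indicator F z *\<^sub>R w z) = 0"
proof (cases "F = {}")
  case False
  define g where "g = (\<lambda>n z. max 0 (1 - real n * infdist z F))"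
  have "(\<lambda>n. LINT z|circle. w z * of_real (g n z)) \<longlonglongrightarrow> (LINT z|circle. indicator F z *\<^sub>R w z)"
  proof (rule integral_dominated_convergence)
    have [measurable]: "w \<in> borel_measurable circle" using w by auto
    have [measurable]: "g n \<in> borel_measurable circle" for n
      unfolding g_def by (intro measurable_circle_continuous continuous_intros)
    have [measurable]: "indicat_real F \<in> borel_measurable circle"
    proof -
      have "{z \<in> space circle. z \<in> F} \<in> sets circle"
        using F by (auto simp: sets_circle space_circle sets_restrict_space image_iff intro!: bexI[of _ F])
      then show ?thesis
        by (subst borel_measurable_indicator_iff) (simp add: Int_def conj_commute)
    qed
    show "(\<lambda>z. indicator F z *\<^sub>R w z) \<in> borel_measurable circle" by measurable
    show "(\<lambda>z. w z * of_real (g n z)) \<in> borel_measurable circle" for n by measurable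
    show "integrable circle (\<lambda>z. cmod (w z))" using w by simp
    show "AE z in circle. cmod (w z * of_real (g n z)) \<le> cmod (w z)" for n
      by (intro AE_I2) (auto simp: norm_mult g_def infdist_nonneg intro!: mult_left_le)
    have "(\<lambda>n. g n z) \<longlonglongrightarrow> indicator F z" for z
    proof (cases "z \<in> F")
      case True
      then show ?thesis by (simp add: g_def)
    next
      case False
      then have pos: "infdist z F > 0"
        using F \<open>F \<noteq> {}\<close> infdist_pos_not_in_closed by blast
      obtain N :: nat where N: "1 / infdist z F < N"
        using reals_Archimedean2 by blast
      have "g n z = 0" if "n \<ge> N" for n
      proof -
        have "1 / infdist z F \<le> real n" using N that by linarith
        then show ?thesis using pos by (simp add: g_def field_simps)
      qed
      then have "eventually (\<lambda>n. g n z = 0) sequentially"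
        by (auto simp: eventually_sequentially)
      then show ?thesis
        using False by (simp add: tendsto_eventually)
    qed
    then have "(\<lambda>n. w z * of_real (g n z)) \<longlonglongrightarrow> w z * of_real (indicator F z)" for z
      by (intro tendsto_intros)
    then show "AE z in circle. (\<lambda>n. w z * of_real (g n z)) \<longlonglongrightarrow> indicator F z *\<^sub>R w z"
      by (simp add: scaleR_conv_of_real mult.commute)
  qed
  moreover have "(LINT z|circle. w z * of_real (g n z)) = 0" for n
    unfolding g_def by (intro vanishing_moments_mult_continuous w moments continuous_intros)
  ultimately show ?thesis by (simp add: LIMSEQ_const_iff)
qed simp

lemma vanishing_moments_imp_AE_zero:
  assumes w: "integrable circle w" and moments: "\<And>n::int. (LINT z|circle. w z * z powi n) = 0"
  shows "AE z in circle. w z = 0"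
proof (rule circle.density_zero[OF w])
  have borel_in: "B \<inter> sphere 0 1 \<in> sets circle" if "B \<in> sets borel" for B
    using that by (auto simp: sets_circle sets_restrict_space)
  have restrict: "(LINT z|circle. indicator B z *\<^sub>R w z) = set_lebesgue_integral circle (B \<inter> sphere 0 1) w" for B
    unfolding set_lebesgue_integral_def
    by (intro Bochner_Integration.integral_cong) (auto simp: space_circle indicator_def)
  have int: "integrable circle (\<lambda>z. indicator B z *\<^sub>R w z)" if "B \<in> sets borel" for B
  proof -
    have "integrable circle (\<lambda>z. indicator (B \<inter> sphere 0 1) z *\<^sub>R w z)"
      using borel_in[OF that] w by (rule integrable_mult_indicator)
    then show ?thesis
      by (rule Bochner_Integration.integrable_cong[THEN iffD1, rotated 2])
        (auto simp: space_circle indicator_def)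
  qed
  have all: "(LINT z|circle. indicator B z *\<^sub>R w z) = 0" if "B \<in> sets borel" for B
  proof -
    have sb: "sets (borel :: complex measure) = sigma_sets UNIV (Collect closed)"
      by (simp add: borel_eq_closed)
    have "Int_stable (Collect closed :: complex set set)"
      by (auto simp: Int_stable_def)
    moreover have "Collect closed \<subseteq> Pow (UNIV :: complex set)"
      by simp
    moreover have "B \<in> sigma_sets UNIV (Collect closed)"
      using that sb by simp
    ultimately show ?thesis
    proof (induction B rule: sigma_sets_induct_disjoint)
      case (basic F)
      then show ?case
        using vanishing_moments_integral_closed[OF w moments] by simp
    next
      case (compl B)
      then have B: "B \<in> sets borel" using sb by simp
      have "(LINT z|circle. indicator (UNIV - B) z *\<^sub>R w z) =
          (LINT z|circle. w z * z powi 0 - indicator B z *\<^sub>R w z)"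
        by (intro Bochner_Integration.integral_cong) (auto simp: indicator_def)
      also have "\<dots> = (LINT z|circle. w z * z powi 0) - (LINT z|circle. indicator B z *\<^sub>R w z)"
        using w int[OF B] by (intro Bochner_Integration.integral_diff) auto
      finally show ?case
        using moments[of 0] compl by simp
    next
      case (union A)
      then have A: "A i \<in> sets borel" for i using sb by auto
      have "(LINT z|circle. indicator (\<Union>i. A i) z *\<^sub>R w z) =
          set_lebesgue_integral circle (\<Union>i. A i \<inter> sphere 0 1) w"
        by (simp add: restrict)
      also have "\<dots> = (\<Sum>i. set_lebesgue_integral circle (A i \<inter> sphere 0 1) w)"
      proof (rule lebesgue_integral_countable_add)
        show "A i \<inter> sphere 0 1 \<in> sets circle" for i by (rule borel_in[OF A])
        show "(A i \<inter> sphere 0 1) \<inter> (A j \<inter> sphere 0 1) = {}" if "i \<noteq> j" for i j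
          using union(1) that by (auto simp: disjoint_family_on_def)
        show "set_integrable circle (\<Union>i. A i \<inter> sphere 0 1) w"
          unfolding set_integrable_def
          using borel_in[OF A] w by (intro integrable_mult_indicator sets.countable_UN) auto
      qed
      also have "\<dots> = 0"
        using union(3) by (simp add: restrict)
      finally show ?case .
    qed simp
  qed
  fix A assume "A \<in> sets circle"
  then have A: "A \<in> sets borel" "A \<subseteq> sphere 0 1"
    by (auto simp: sets_circle sets_restrict_space)
  then show "set_lebesgue_integral circle A w = 0"
    using all[OF A(1)] by (simp add: set_lebesgue_integral_def)
qed

section \<open>Hardy space\<close>

lemma l2_inner_add_right:
  "f \<in> L2 \<Longrightarrow> g \<in> L2 \<Longrightarrow> h \<in> L2 \<Longrightarrow> l2_inner h (\<lambda>z. f z + g z) = l2_inner h f + l2_inner h g"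
  using l2_inner_add_left[of f g h] by (metis complex_cnj_add l2_inner_commute)

lemma l2_inner_scale_right: "l2_inner g (\<lambda>z. c * f z) = cnj c * l2_inner g f"
  using l2_inner_scale_left[of c f g] by (metis complex_cnj_mult l2_inner_commute)

lemma l2_inner_mult_left: "l2_inner (\<lambda>z. a z * f z) g = l2_inner f (\<lambda>z. cnj (a z) * g z)"
  by (simp add: l2_inner_def mult_ac)

lemma l2_inner_cnj: "l2_inner (\<lambda>z. cnj (f z)) (\<lambda>z. cnj (g z)) = cnj (l2_inner f g)"
  unfolding l2_inner_def by (subst Bochner_Integration.integral_cnj[symmetric]) simp

lemma l2_inner_powi_left:
  "l2_inner (\<lambda>z. z powi n * f z) g = l2_inner f (\<lambda>z. z powi (-n) * g z)"
  unfolding l2_inner_mult_left by (intro l2_inner_cong) (simp add: cnj_powi_on_circle)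

lemma l2_inner_shift: "l2_inner (\<lambda>z. z * f z) (\<lambda>z. z * g z) = l2_inner f g"
proof (rule l2_inner_cong)
  fix z assume "z \<in> space circle"
  then have "z * cnj z = 1"
    using complex_norm_square[of z] norm_on_circle by simp
  then have "(z * cnj z) * (f z * cnj (g z)) = f z * cnj (g z)"
    by simp
  then show "z * f z * cnj (z * g z) = f z * cnj (g z)"
    by (simp add: mult_ac)
qed

lemma l2_norm_shift: "l2_norm (\<lambda>z. z * f z) = l2_norm f"
  using l2_inner_shift[of f f] unfolding l2_inner_self
  by (metis l2_norm_nonneg of_real_eq_iff power2_eq_iff_nonneg)

lemma L2_shift [intro]: "f \<in> L2 \<Longrightarrow> (\<lambda>z. z * f z) \<in> L2"
  by (rule Linf_mult_L2[OF Linf_ident])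

lemma orth_diff_add:
  assumes "X \<subseteq> L2" "f \<in> L2 \<ominus> X" "g \<in> L2 \<ominus> X"
  shows "(\<lambda>z. f z + g z) \<in> L2 \<ominus> X"
  using assms by (auto simp: orth_diff_def l2_inner_add_left subset_iff)

lemma orth_diff_diff:
  assumes "X \<subseteq> L2" "f \<in> L2 \<ominus> X" "g \<in> L2 \<ominus> X"
  shows "(\<lambda>z. f z - g z) \<in> L2 \<ominus> X"
  using assms by (auto simp: orth_diff_def l2_inner_diff_left subset_iff)

lemma orth_diff_scale: "f \<in> L2 \<ominus> X \<Longrightarrow> (\<lambda>z. c * f z) \<in> L2 \<ominus> X"
  by (auto simp: orth_diff_def l2_inner_scale_left)

lemma H2_eq_orth_diff: "H2 = L2 \<ominus> (\<lambda>n z. z powi n) ` {..<0::int}"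
  by (auto simp: H2_def orth_diff_def)

lemma H2_subset_L2: "H2 \<subseteq> L2"
  by (auto simp: H2_def)

lemma H2_orthogonal_powi: "h \<in> H2 \<Longrightarrow> n < 0 \<Longrightarrow> l2_inner h (\<lambda>z. z powi n) = 0"
  by (simp add: H2_def)

lemma H2_powi: "n \<ge> 0 \<Longrightarrow> (\<lambda>z. z powi n) \<in> H2"
  by (auto simp: H2_def l2_inner_powi_powi)

lemma H2_add: "f \<in> H2 \<Longrightarrow> g \<in> H2 \<Longrightarrow> (\<lambda>z. f z + g z) \<in> H2"
  and H2_diff: "f \<in> H2 \<Longrightarrow> g \<in> H2 \<Longrightarrow> (\<lambda>z. f z - g z) \<in> H2"
  and H2_scale: "f \<in> H2 \<Longrightarrow> (\<lambda>z. c * f z) \<in> H2"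
  unfolding H2_eq_orth_diff by (auto intro!: orth_diff_add orth_diff_diff orth_diff_scale)

lemma H2_const: "(\<lambda>z. c) \<in> H2"
  using H2_scale[OF H2_powi[of 0], of c] by simp

lemma orthogonal_powi_imp_AE_zero:
  assumes u: "u \<in> L2" and orth: "\<And>n::int. l2_inner u (\<lambda>z. z powi n) = 0"
  shows "AE z in circle. u z = 0"
proof (rule vanishing_moments_imp_AE_zero)
  show "integrable circle u"
    using L2_integrable_mult_cnj[OF u L2_const[of 1]] by simp
  fix n :: int
  have "(LINT z|circle. u z * z powi n) = l2_inner u (\<lambda>z. z powi (-n))"
    unfolding l2_inner_def by (intro Bochner_Integration.integral_cong) (simp_all add: cnj_powi_on_circle)
  then show "(LINT z|circle. u z * z powi n) = 0"
    using orth by simp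
qed

text \<open>
  The monomials need not be expanded into a series: the subspace of all \<open>h\<close> in \<open>H\<^sup>2\<close> orthogonal
  to \<open>u\<close> contains them, hence is dense by uniqueness of Fourier coefficients, and it is closed.
\<close>

lemma orthogonal_monomials_imp_orthogonal_H2:
  assumes u: "u \<in> L2" and orth: "\<And>n::int. n \<ge> 0 \<Longrightarrow> l2_inner u (\<lambda>z. z powi n) = 0"
    and h: "h \<in> H2"
  shows "l2_inner h u = 0"
proof -
  define S where "S = {s \<in> H2. l2_inner s u = 0}"
  have "cmod (l2_inner h u) \<le> 0"
  proof (rule field_le_epsilon)
    fix e :: real assume "e > 0"
    then have pos: "e / (l2_norm u + 1) > 0"
      by (intro divide_pos_pos add_nonneg_pos) auto
    obtain s where s: "s \<in> S" and close: "l2_norm (\<lambda>z. h z - s z) < e / (l2_norm u + 1)"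
    proof (rule trivial_annihilator_imp_dense[of "(\<lambda>n z. z powi n) ` {..<0::int}" S h "e / (l2_norm u + 1)"])
      fix v assume v: "v \<in> L2 \<ominus> (\<lambda>n z. z powi n) ` {..<0::int}" and vS: "\<forall>s\<in>S. l2_inner v s = 0"
      show "AE z in circle. v z = 0"
      proof (rule orthogonal_powi_imp_AE_zero)
        show "v \<in> L2" using v by (simp add: orth_diff_def)
        fix n :: int
        show "l2_inner v (\<lambda>z. z powi n) = 0"
        proof (cases "n < 0")
          case True
          then show ?thesis using v by (auto simp: orth_diff_def)
        next
          case False
          then have "(\<lambda>z. z powi n) \<in> S"
            using orth[of n] H2_powi[of n] by (auto simp: S_def l2_inner_eq_0_commute)
          then show ?thesis using vS by blast
        qed
      qed
    next
      show "(\<lambda>n z. z powi n) ` {..<0::int} \<subseteq> L2" by auto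
      show "S \<subseteq> L2 \<ominus> (\<lambda>n z. z powi n) ` {..<0::int}"
        unfolding H2_eq_orth_diff[symmetric] by (auto simp: S_def)
      have "(\<lambda>z. 0) \<in> S"
        using H2_const[of 0] by (simp add: S_def l2_inner_def)
      then show "S \<noteq> {}" by blast
      show "(\<lambda>z. s z + t z) \<in> S" if "s \<in> S" "t \<in> S" for s t
        using that u H2_subset_L2 by (auto simp: S_def H2_add l2_inner_add_left subset_iff)
      show "(\<lambda>z. c * s z) \<in> S" if "s \<in> S" for c s
        using that by (auto simp: S_def H2_scale l2_inner_scale_left)
      show "h \<in> L2 \<ominus> (\<lambda>n z. z powi n) ` {..<0::int}"
        using h unfolding H2_eq_orth_diff .
    qed (use pos that in auto)
    have hs: "h \<in> L2" "s \<in> L2" using h s H2_subset_L2 by (auto simp: S_def)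
    have "l2_inner h u = l2_inner (\<lambda>z. h z - s z) u"
      using s u hs by (simp add: S_def l2_inner_diff_left)
    then have "cmod (l2_inner h u) \<le> l2_norm (\<lambda>z. h z - s z) * l2_norm u"
      using l2_Cauchy_Schwarz[OF L2_diff[OF hs] u] by simp
    also have "\<dots> \<le> e / (l2_norm u + 1) * (l2_norm u + 1)"
      using close pos by (intro mult_mono) auto
    also have "\<dots> = 0 + e"
      using add_nonneg_pos[of "l2_norm u" 1] by simp
    finally show "cmod (l2_inner h u) \<le> 0 + e" .
  qed
  then show ?thesis by simp
qed

text \<open>
  Moving \<open>a\<close> to the other side of the inner product leaves \<open>h\<close> paired with
  \<open>cnj a * z powi n\<close>, which for \<open>n < 0\<close> has only negative frequencies.
\<close>

lemma H2_mult:
  assumes a: "a \<in> H2 \<inter> Linf" and h: "h \<in> H2"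
  shows "(\<lambda>z. a z * h z) \<in> H2"
proof -
  have hL: "h \<in> L2" and aL: "a \<in> L2" using h a H2_subset_L2 by auto
  have "l2_inner (\<lambda>z. a z * h z) (\<lambda>z. z powi n) = 0" if "n < 0" for n
  proof -
    have "l2_inner h (\<lambda>z. cnj (a z) * z powi n) = 0"
    proof (rule orthogonal_monomials_imp_orthogonal_H2[OF _ _ h])
      show "(\<lambda>z. cnj (a z) * z powi n) \<in> L2"
        using a by (intro Linf_mult_L2 Linf_cnj) auto
      fix m :: int assume "m \<ge> 0"
      have "l2_inner (\<lambda>z. cnj (a z) * z powi n) (\<lambda>z. z powi m) =
          l2_inner (\<lambda>z. z powi n) (\<lambda>z. a z * z powi m)"
        by (simp add: l2_inner_mult_left)
      also have "\<dots> = l2_inner (\<lambda>z. z powi (n - m)) a"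
        unfolding l2_inner_def
      proof (intro Bochner_Integration.integral_cong refl)
        fix z assume z: "z \<in> space circle"
        then have "z \<noteq> 0" using norm_on_circle by fastforce
        then have "z powi n * z powi (-m) = z powi (n - m)"
          using power_int_add[of z n "-m"] by simp
        then show "z powi n * cnj (a z * z powi m) = z powi (n - m) * cnj (a z)"
          unfolding complex_cnj_mult complex_cnj_power_int cnj_powi_on_circle[OF z] by (metis mult.assoc mult.commute)
      qed
      also have "\<dots> = 0"
        using a \<open>n < 0\<close> \<open>m \<ge> 0\<close> by (subst l2_inner_eq_0_commute) (simp add: H2_def)
      finally show "l2_inner (\<lambda>z. cnj (a z) * z powi n) (\<lambda>z. z powi m) = 0" .
    qed
    then show ?thesis by (simp add: l2_inner_mult_left)
  qed
  moreover have "(\<lambda>z. a z * h z) \<in> L2"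
    using a hL by (intro Linf_mult_L2) auto
  ultimately show ?thesis by (simp add: H2_def)
qed

lemma H2_shift: "h \<in> H2 \<Longrightarrow> (\<lambda>z. z * h z) \<in> H2"
  using H2_mult[of "\<lambda>z. z" h] H2_powi[of 1] by simp

lemma H2_divide_ident:
  assumes "h \<in> H2" "l2_inner h (\<lambda>z. 1) = 0"
  shows "(\<lambda>z. z powi (-1) * h z) \<in> H2"
proof -
  have "l2_inner (\<lambda>z. z powi (-1) * h z) (\<lambda>z. z powi n) = 0" if "n < 0" for n
  proof -
    have "l2_inner (\<lambda>z. z powi (-1) * h z) (\<lambda>z. z powi n) = l2_inner h (\<lambda>z. z powi (n + 1))"
      unfolding l2_inner_powi_left
    proof (rule l2_inner_cong)
      fix z assume "z \<in> space circle"
      then have "z \<noteq> 0" using norm_on_circle by fastforce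
      then show "h z * cnj (z powi - (-1) * z powi n) = h z * cnj (z powi (n + 1))"
        by (simp add: power_int_add mult.commute)
    qed
    also have "\<dots> = 0"
      using assms that by (cases "n = -1") (auto simp: H2_def)
    finally show ?thesis .
  qed
  moreover have "(\<lambda>z. z powi (-1) * h z) \<in> L2"
    using assms H2_subset_L2 by (intro Linf_mult_L2 Linf_powi) auto
  ultimately show ?thesis by (simp add: H2_def)
qed

lemma l2_inner_one_one: "l2_inner (\<lambda>z. 1) (\<lambda>z. 1) = 1"
  using l2_inner_powi_powi[of 0 0] by simp

text \<open>The pairing with \<open>1\<close> is evaluation at the origin, hence multiplicative.\<close>

lemma l2_inner_one_mult:
  assumes a: "a \<in> H2 \<inter> Linf" and h: "h \<in> H2"
  shows "l2_inner (\<lambda>z. a z * h z) (\<lambda>z. 1) = l2_inner a (\<lambda>z. 1) * l2_inner h (\<lambda>z. 1)"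
proof -
  define h0 where "h0 = l2_inner h (\<lambda>z. 1)"
  define k where "k = (\<lambda>z. z powi (-1) * (h z - h0))"
  have hL: "h \<in> L2" and aL: "a \<in> L2" using h a H2_subset_L2 by auto
  have "l2_inner (\<lambda>z. h z - h0) (\<lambda>z. 1) = h0 - h0 * l2_inner (\<lambda>z. 1) (\<lambda>z. 1)"
    using hL l2_inner_scale_left[of h0 "\<lambda>z. 1" "\<lambda>z. 1"] by (simp add: l2_inner_diff_left h0_def)
  then have "k \<in> H2"
    unfolding k_def using h by (intro H2_divide_ident H2_diff H2_const) (auto simp: l2_inner_one_one)
  then have ak: "(\<lambda>z. a z * k z) \<in> H2"
    using a by (intro H2_mult)
  have "l2_inner (\<lambda>z. a z * h z) (\<lambda>z. 1) =
      l2_inner (\<lambda>z. h0 * a z + z powi 1 * (a z * k z)) (\<lambda>z. 1)"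
  proof (rule l2_inner_cong)
    fix z assume "z \<in> space circle"
    then have "z \<noteq> 0" using norm_on_circle by fastforce
    then show "a z * h z * cnj 1 = (h0 * a z + z powi 1 * (a z * k z)) * cnj 1"
      by (simp add: k_def field_simps)
  qed
  also have "\<dots> = h0 * l2_inner a (\<lambda>z. 1) + l2_inner (\<lambda>z. z powi 1 * (a z * k z)) (\<lambda>z. 1)"
    using aL ak H2_subset_L2 by (subst l2_inner_add_left) (auto simp: l2_inner_scale_left)
  also have "l2_inner (\<lambda>z. z powi 1 * (a z * k z)) (\<lambda>z. 1) = l2_inner (\<lambda>z. a z * k z) (\<lambda>z. z powi (-1))"
    by (subst l2_inner_powi_left) simp
  also have "\<dots> = 0"
    by (rule H2_orthogonal_powi[OF ak]) simp
  finally show ?thesis by (simp add: h0_def)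
qed

section \<open>The orthogonal complement of a model space\<close>

lemma inner_function_H2: "inner_function \<theta> \<Longrightarrow> \<theta> \<in> H2 \<inter> Linf"
  by (simp add: inner_function_def)

lemma l2_inner_inner_function_mult:
  assumes "inner_function \<theta>" "f \<in> L2" "g \<in> L2"
  shows "l2_inner (\<lambda>z. \<theta> z * f z) (\<lambda>z. \<theta> z * g z) = l2_inner f g"
proof (rule l2_inner_cong_AE)
  have \<theta>: "\<theta> \<in> Linf" and unimodular: "AE z in circle. cmod (\<theta> z) = 1"
    using assms(1) by (auto simp: inner_function_def)
  from unimodular show "AE z in circle. \<theta> z * f z * cnj (\<theta> z * g z) = f z * cnj (g z)"
  proof eventually_elim
    case (elim z)
    then have "\<theta> z * cnj (\<theta> z) = 1"
      using complex_norm_square[of "\<theta> z"] by simp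
    then have "(\<theta> z * cnj (\<theta> z)) * (f z * cnj (g z)) = f z * cnj (g z)"
      by simp
    then show ?case by (simp add: mult_ac)
  qed
  show "(\<lambda>z. \<theta> z * f z) \<in> L2" "(\<lambda>z. \<theta> z * g z) \<in> L2"
    using \<theta> assms by (auto intro!: Linf_mult_L2)
qed (use assms in auto)

lemma K_memI:
  assumes "f \<in> H2" "\<And>h. h \<in> H2 \<Longrightarrow> l2_inner f (\<lambda>z. \<theta> z * h z) = 0"
  shows "f \<in> K \<theta>"
  using assms by (auto simp: K_def orth_diff_def)

lemma K_memD:
  assumes "f \<in> K \<theta>"
  shows "f \<in> H2" and "h \<in> H2 \<Longrightarrow> l2_inner f (\<lambda>z. \<theta> z * h z) = 0"
  using assms by (auto simp: K_def orth_diff_def)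

lemma K_subset_L2: "K \<theta> \<subseteq> L2"
  using K_memD(1) H2_subset_L2 by blast

lemma K_perp_iff: "f \<in> K_perp \<theta> \<longleftrightarrow> f \<in> L2 \<and> (\<forall>k\<in>K \<theta>. l2_inner f k = 0)"
  by (simp add: K_perp_def orth_diff_def)

lemma K_perp_subset_L2: "K_perp \<theta> \<subseteq> L2"
  by (auto simp: K_perp_iff)

lemma K_perp_add: "f \<in> K_perp \<theta> \<Longrightarrow> g \<in> K_perp \<theta> \<Longrightarrow> (\<lambda>z. f z + g z) \<in> K_perp \<theta>"
  unfolding K_perp_def by (rule orth_diff_add[OF K_subset_L2])

lemma K_perp_diff: "f \<in> K_perp \<theta> \<Longrightarrow> g \<in> K_perp \<theta> \<Longrightarrow> (\<lambda>z. f z - g z) \<in> K_perp \<theta>"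
  unfolding K_perp_def by (rule orth_diff_diff[OF K_subset_L2])

lemma K_perp_scale: "f \<in> K_perp \<theta> \<Longrightarrow> (\<lambda>z. c * f z) \<in> K_perp \<theta>"
  unfolding K_perp_def by (rule orth_diff_scale)

lemma powi_mem_K_perp:
  assumes "n < 0"
  shows "(\<lambda>z. z powi n) \<in> K_perp \<theta>"
  unfolding K_perp_iff
  using assms H2_orthogonal_powi[OF K_memD(1)] l2_inner_eq_0_commute by blast

lemma inner_function_mult_mem_K_perp:
  assumes "inner_function \<theta>" "h \<in> H2"
  shows "(\<lambda>z. \<theta> z * h z) \<in> K_perp \<theta>"
proof -
  have "(\<lambda>z. \<theta> z * h z) \<in> L2"
    using H2_mult[OF inner_function_H2] assms H2_subset_L2 by blast
  then show ?thesis
    unfolding K_perp_iff using K_memD(2) assms(2) l2_inner_eq_0_commute by blast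
qed

lemma l2_inner_cnj_ident: "l2_inner f (\<lambda>z. cnj z) = l2_inner f (\<lambda>z. z powi (-1))"
  using cnj_powi_on_circle[of _ 1] by (intro l2_inner_cong) simp

lemma L2_cnj_ident [intro, simp]: "(\<lambda>z. cnj z) \<in> L2"
  using Linf_ident Linf_subset_L2 by blast

lemma cnj_ident_mem_K_perp: "(\<lambda>z. cnj z) \<in> K_perp \<theta>"
  unfolding K_perp_iff
  by (auto simp: l2_inner_eq_0_commute[of "\<lambda>z. cnj z"] l2_inner_cnj_ident
      intro!: H2_orthogonal_powi K_memD(1) simp del: power_int_minus1_right)

text \<open>
  For \<open>k\<close> in \<open>K \<theta>\<close>, the function \<open>cnj z * k\<close> differs from the backward shift of \<open>k\<close>, which
  stays in \<open>K \<theta>\<close>, only by a multiple of \<open>cnj z\<close>. Both are orthogonal to \<open>f\<close>.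
\<close>

lemma shift_mem_K_perp:
  assumes \<theta>: "inner_function \<theta>" and f: "f \<in> K_perp \<theta>" and orth: "l2_inner f (\<lambda>z. cnj z) = 0"
  shows "(\<lambda>z. z * f z) \<in> K_perp \<theta>"
proof -
  have fL: "f \<in> L2" using f K_perp_subset_L2 by blast
  have "l2_inner (\<lambda>z. z * f z) k = 0" if k: "k \<in> K \<theta>" for k
  proof -
    define k0 where "k0 = l2_inner k (\<lambda>z. 1)"
    define b where "b = (\<lambda>z. z powi (-1) * (k z - k0))"
    have kH: "k \<in> H2" and kL: "k \<in> L2" using K_memD(1)[OF k] H2_subset_L2 by auto
    have "l2_inner (\<lambda>z. k z - k0) (\<lambda>z. 1) = k0 - k0 * l2_inner (\<lambda>z. 1) (\<lambda>z. 1)"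
      using kL l2_inner_scale_left[of k0 "\<lambda>z. 1" "\<lambda>z. 1"] by (simp add: l2_inner_diff_left k0_def)
    then have bH: "b \<in> H2"
      unfolding b_def using kH by (intro H2_divide_ident H2_diff H2_const) (auto simp: l2_inner_one_one)
    have "b \<in> K \<theta>"
    proof (rule K_memI[OF bH])
      fix h assume h: "h \<in> H2"
      define w where "w = (\<lambda>z. \<theta> z * (z * h z))"
      have \<theta>h: "(\<lambda>z. \<theta> z * h z) \<in> H2"
        using H2_mult[OF inner_function_H2[OF \<theta>] h] .
      have wL: "w \<in> L2"
        unfolding w_def using H2_mult[OF inner_function_H2[OF \<theta>] H2_shift[OF h]] H2_subset_L2 by blast
      have "l2_inner b (\<lambda>z. \<theta> z * h z) = l2_inner (\<lambda>z. k z - k0) w"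
        unfolding b_def l2_inner_powi_left w_def by (simp add: mult_ac)
      also have "\<dots> = l2_inner k w - k0 * l2_inner (\<lambda>z. 1) w"
        using kL wL l2_inner_scale_left[of k0 "\<lambda>z. 1" w] by (simp add: l2_inner_diff_left)
      also have "l2_inner k w = 0"
        unfolding w_def using K_memD(2)[OF k H2_shift[OF h]] .
      also have "l2_inner w (\<lambda>z. 1) = l2_inner (\<lambda>z. \<theta> z * h z) (\<lambda>z. z powi (-1))"
        using l2_inner_powi_left[of 1 "\<lambda>z. \<theta> z * h z" "\<lambda>z. 1"] by (simp add: w_def mult_ac)
      then have "l2_inner (\<lambda>z. 1) w = 0"
        using H2_orthogonal_powi[OF \<theta>h, of "-1"] l2_inner_eq_0_commute by simp
      finally show "l2_inner b (\<lambda>z. \<theta> z * h z) = 0" by simp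
    qed
    have "l2_inner (\<lambda>z. z * f z) k = l2_inner f (\<lambda>z. b z + k0 * cnj z)"
    proof (subst l2_inner_mult_left, rule l2_inner_cong)
      fix z assume z: "z \<in> space circle"
      then have "cnj z = z powi (-1)"
        using cnj_powi_on_circle[OF z, of 1] by simp
      then have "cnj z * k z = b z + k0 * cnj z"
        by (simp add: b_def algebra_simps)
      then show "f z * cnj (cnj z * k z) = f z * cnj (b z + k0 * cnj z)"
        by (simp only:)
    qed
    also have "\<dots> = l2_inner f b + cnj k0 * l2_inner f (\<lambda>z. cnj z)"
      using fL bH H2_subset_L2 by (subst l2_inner_add_right) (auto simp: l2_inner_scale_right)
    also have "\<dots> = 0"
      using f \<open>b \<in> K \<theta>\<close> orth by (simp add: K_perp_iff)
    finally show ?thesis .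
  qed
  then show ?thesis
    using fL by (auto simp: K_perp_iff)
qed

text \<open>This is the reproducing kernel of \<open>K \<theta>\<close> at the origin.\<close>

lemma kernel_mem_K:
  assumes \<theta>: "inner_function \<theta>"
  shows "(\<lambda>z. 1 - cnj (l2_inner \<theta> (\<lambda>z. 1)) * \<theta> z) \<in> K \<theta>"
proof (rule K_memI)
  note \<theta>H = inner_function_H2[OF \<theta>]
  have \<theta>L: "\<theta> \<in> L2" using \<theta>H H2_subset_L2 by auto
  show "(\<lambda>z. 1 - cnj (l2_inner \<theta> (\<lambda>z. 1)) * \<theta> z) \<in> H2"
    using \<theta>H by (intro H2_diff H2_const H2_scale) auto
  fix h assume h: "h \<in> H2"
  have hL: "h \<in> L2" and \<theta>hL: "(\<lambda>z. \<theta> z * h z) \<in> L2"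
    using h H2_mult[OF \<theta>H h] H2_subset_L2 by auto
  have "l2_inner \<theta> (\<lambda>z. \<theta> z * h z) = l2_inner (\<lambda>z. 1) h"
    using l2_inner_inner_function_mult[OF \<theta> L2_const[of 1] hL] by simp
  moreover have "l2_inner (\<lambda>z. 1) (\<lambda>z. \<theta> z * h z) = cnj (l2_inner \<theta> (\<lambda>z. 1)) * l2_inner (\<lambda>z. 1) h"
    using l2_inner_one_mult[OF \<theta>H h] by (metis complex_cnj_mult l2_inner_commute)
  ultimately show "l2_inner (\<lambda>z. 1 - cnj (l2_inner \<theta> (\<lambda>z. 1)) * \<theta> z) (\<lambda>z. \<theta> z * h z) = 0"
    using \<theta>L \<theta>hL L2_scale[OF \<theta>L] by (simp add: l2_inner_diff_left l2_inner_scale_left)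
qed

text \<open>
  Subtracting from \<open>f\<close> its component along \<open>cnj z\<close> leaves a function whose shift is in the
  complement, so the shift of the component, a constant, is in it too. But a nonzero constant is
  not orthogonal to the reproducing kernel at the origin: the pairing of \<open>1\<close> with it is
  \<open>1 - |\<theta>(0)|\<^sup>2\<close>, which is the squared distance of \<open>\<theta>\<close> to the constant \<open>\<theta>(0)\<close>.
\<close>

lemma shift_mem_K_perp_imp_orthogonal:
  assumes \<theta>: "inner_function \<theta>" and nonconst: "nonconstant \<theta>"
    and f: "f \<in> K_perp \<theta>" and zf: "(\<lambda>z. z * f z) \<in> K_perp \<theta>"
  shows "l2_inner f (\<lambda>z. cnj z) = 0"
proof -
  define c where "c = l2_inner f (\<lambda>z. cnj z)"
  define \<theta>0 where "\<theta>0 = l2_inner \<theta> (\<lambda>z. 1)"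
  define r where "r = (\<lambda>z. f z - c * cnj z)"
  define k where "k = (\<lambda>z. 1 - cnj \<theta>0 * \<theta> z)"
  have fL: "f \<in> L2" using f K_perp_subset_L2 by blast
  have \<theta>L: "\<theta> \<in> L2" using inner_function_H2[OF \<theta>] H2_subset_L2 by auto
  have k: "k \<in> K \<theta>" unfolding k_def \<theta>0_def by (rule kernel_mem_K[OF \<theta>])
  then have kL: "k \<in> L2" using K_subset_L2 by blast
  have "l2_inner (\<lambda>z. cnj z) (\<lambda>z. cnj z) = 1"
    using l2_inner_cnj[of "\<lambda>z. z" "\<lambda>z. z"] l2_inner_powi_powi[of 1 1] by simp
  then have "l2_inner r (\<lambda>z. cnj z) = 0"
    unfolding r_def using fL L2_scale[OF L2_cnj_ident]
    by (simp add: l2_inner_diff_left l2_inner_scale_left c_def)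
  moreover have "r \<in> K_perp \<theta>"
    unfolding r_def using f by (intro K_perp_diff K_perp_scale cnj_ident_mem_K_perp)
  ultimately have "(\<lambda>z. z * r z) \<in> K_perp \<theta>"
    using shift_mem_K_perp[OF \<theta>] by blast
  then have "l2_inner (\<lambda>z. z * f z - z * r z) k = 0"
    using K_perp_diff[OF zf] k by (auto simp: K_perp_iff)
  also have "l2_inner (\<lambda>z. z * f z - z * r z) k = l2_inner (\<lambda>z. c * 1) k"
  proof (rule l2_inner_cong)
    fix z assume "z \<in> space circle"
    then have "z * cnj z = 1"
      using complex_norm_square[of z] norm_on_circle by simp
    then have "z * f z - z * r z = c * 1"
      by (simp add: r_def algebra_simps)
    then show "(z * f z - z * r z) * cnj (k z) = c * 1 * cnj (k z)"
      by (simp only:)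
  qed
  also have "\<dots> = c * (1 - \<theta>0 * cnj \<theta>0)"
  proof -
    have "l2_inner k (\<lambda>z. 1) = 1 - cnj \<theta>0 * \<theta>0"
      unfolding k_def using \<theta>L L2_scale[OF \<theta>L]
      by (simp add: l2_inner_diff_left l2_inner_scale_left l2_inner_one_one \<theta>0_def)
    then have "l2_inner (\<lambda>z. 1) k = 1 - \<theta>0 * cnj \<theta>0"
      by (subst l2_inner_commute) simp
    then show ?thesis
      by (simp only: l2_inner_scale_left)
  qed
  finally have eq: "c * (1 - \<theta>0 * cnj \<theta>0) = 0" .
  have "1 - \<theta>0 * cnj \<theta>0 \<noteq> 0"
  proof
    assume "1 - \<theta>0 * cnj \<theta>0 = 0"
    then have one: "(cmod \<theta>0)\<^sup>2 = 1"
      using complex_norm_square[of \<theta>0] by (metis eq_iff_diff_eq_0 of_real_eq_1_iff)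
    have norm1: "(l2_norm (\<lambda>z. 1))\<^sup>2 = 1"
      using l2_inner_self[of "\<lambda>z. 1"] l2_inner_one_one by (metis of_real_eq_1_iff)
    have "l2_inner \<theta> \<theta> = 1"
      using l2_inner_inner_function_mult[OF \<theta> L2_const[of 1] L2_const[of 1]] l2_inner_one_one by simp
    then have norm\<theta>: "(l2_norm \<theta>)\<^sup>2 = 1"
      using l2_inner_self[of \<theta>] by (metis of_real_eq_1_iff)
    have "cnj \<theta>0 * \<theta>0 = of_real 1"
      using one complex_norm_square[of \<theta>0] by (simp add: mult.commute)
    then have "Re (cnj \<theta>0 * \<theta>0) = 1"
      by (simp only: Re_complex_of_real)
    then have "(l2_norm (\<lambda>z. \<theta> z - \<theta>0 * 1))\<^sup>2 = 0"
      using l2_norm_square_diff_scale[OF \<theta>L L2_const[of 1], of \<theta>0] one norm1 norm\<theta>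
      unfolding \<theta>0_def[symmetric] by simp
    then have "AE z in circle. \<theta> z - \<theta>0 = 0"
      using \<theta>L by (intro l2_norm_eq_0_imp_AE) (auto intro!: L2_diff)
    then have "AE z in circle. \<theta> z = \<theta>0" by simp
    then show False using nonconst by (auto simp: nonconstant_def)
  qed
  with eq show ?thesis by (simp add: c_def)
qed

text \<open>
  A function in the complement of \<open>K \<theta>\<close> annihilated by all bounded members orthogonal to
  \<open>cnj z\<close>, and itself orthogonal to \<open>cnj z\<close>, is orthogonal to all \<open>z powi n\<close> with \<open>n < 0\<close> and to
  \<open>\<theta> H2\<close>. So it lies in \<open>K \<theta>\<close> as well and is zero.
\<close>

lemma bounded_dense_in_K_perp_orthogonal:
  assumes \<theta>: "inner_function \<theta>" and f: "f \<in> K_perp \<theta>" and orth: "l2_inner f (\<lambda>z. cnj z) = 0"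
    and "e > 0"
  obtains s where "s \<in> K_perp \<theta> \<inter> Linf" "l2_inner s (\<lambda>z. cnj z) = 0" "l2_norm (\<lambda>z. f z - s z) < e"
proof -
  define X where "X = insert (\<lambda>z. cnj z) (K \<theta>)"
  define S where "S = {s \<in> K_perp \<theta> \<inter> Linf. l2_inner s (\<lambda>z. cnj z) = 0}"
  have X_iff: "u \<in> L2 \<ominus> X \<longleftrightarrow> u \<in> K_perp \<theta> \<and> l2_inner u (\<lambda>z. cnj z) = 0" for u
    by (auto simp: X_def K_perp_iff orth_diff_def)
  obtain s where "s \<in> S" "l2_norm (\<lambda>z. f z - s z) < e"
  proof (rule trivial_annihilator_imp_dense[of X S f e])
    fix u assume u: "u \<in> L2 \<ominus> X" and uS: "\<forall>s\<in>S. l2_inner u s = 0"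
    have uL: "u \<in> L2" using u by (simp add: orth_diff_def)
    have "l2_inner u (\<lambda>z. z powi n) = 0" if "n < 0" for n
    proof (cases "n = -1")
      case True
      then show ?thesis using u by (simp only: X_iff l2_inner_cnj_ident)
    next
      case False
      then have "l2_inner (\<lambda>z. z powi n) (\<lambda>z. cnj z) = 0"
        unfolding l2_inner_cnj_ident l2_inner_powi_powi by simp
      then have "(\<lambda>z. z powi n) \<in> S"
        using powi_mem_K_perp[OF that] by (simp add: S_def)
      then show ?thesis using uS by blast
    qed
    then have uH: "u \<in> H2" using uL by (simp add: H2_def)
    have "u \<in> K \<theta>"
    proof (rule K_memI[OF uH])
      fix h assume h: "h \<in> H2"
      have "l2_inner h (\<lambda>z. cnj (\<theta> z) * u z) = 0"
      proof (rule orthogonal_monomials_imp_orthogonal_H2[OF _ _ h])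
        show "(\<lambda>z. cnj (\<theta> z) * u z) \<in> L2"
          using inner_function_H2[OF \<theta>] uL by (intro Linf_mult_L2 Linf_cnj) auto
        fix n :: int assume "n \<ge> 0"
        then have n: "(\<lambda>z. z powi n) \<in> H2" by (rule H2_powi)
        have "(\<lambda>z. \<theta> z * z powi n) \<in> S"
          unfolding S_def l2_inner_cnj_ident
          using inner_function_mult_mem_K_perp[OF \<theta> n] inner_function_H2[OF \<theta>]
            H2_orthogonal_powi[OF H2_mult[OF inner_function_H2[OF \<theta>] n], of "-1"]
          by (auto intro!: Linf_mult)
        then show "l2_inner (\<lambda>z. cnj (\<theta> z) * u z) (\<lambda>z. z powi n) = 0"
          using uS by (simp add: l2_inner_mult_left)
      qed
      then show "l2_inner u (\<lambda>z. \<theta> z * h z) = 0"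
        by (subst l2_inner_eq_0_commute) (simp add: l2_inner_mult_left)
    qed
    then have "l2_inner u u = 0"
      using u by (auto simp: X_iff K_perp_iff)
    then show "AE z in circle. u z = 0"
      using uL by (intro l2_norm_eq_0_imp_AE) (auto simp: l2_inner_self)
  next
    show "X \<subseteq> L2" using K_subset_L2 by (auto simp: X_def)
    show "S \<subseteq> L2 \<ominus> X" by (auto simp: S_def X_iff)
    have "(\<lambda>z. z powi (-2)) \<in> S"
      using powi_mem_K_perp[of "-2"] l2_inner_powi_powi[of "-2" "-1"]
      unfolding S_def l2_inner_cnj_ident mem_Collect_eq by (simp only: Int_iff Linf_powi) simp
    then show "S \<noteq> {}" by blast
    show "(\<lambda>z. s z + t z) \<in> S" if "s \<in> S" "t \<in> S" for s t
      using that K_perp_subset_L2[of \<theta>]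
      by (auto simp: S_def l2_inner_add_left subset_iff intro!: K_perp_add)
    show "(\<lambda>z. c * s z) \<in> S" if "s \<in> S" for c s
      using that by (auto simp: S_def l2_inner_scale_left intro!: K_perp_scale Linf_mult)
    show "f \<in> L2 \<ominus> X" using f orth by (simp add: X_iff)
  qed (use \<open>e > 0\<close> in auto)
  then show ?thesis using that by (auto simp: S_def)
qed

section \<open>Shift invariance\<close>

lemma bounded_operator_inner_diff_le:
  assumes D: "bounded_operator M N D" and N: "N \<subseteq> L2"
    and bound: "\<And>f. f \<in> M \<Longrightarrow> l2_norm (D f) \<le> C * l2_norm f"
    and f: "f \<in> M" and s: "s \<in> M" and fs: "(\<lambda>z. f z - s z) \<in> M" and g: "g \<in> L2"
  shows "cmod (l2_inner (D f) g - l2_inner (D s) g) \<le> C * l2_norm (\<lambda>z. f z - s z) * l2_norm g"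
proof -
  let ?r = "\<lambda>z. f z - s z"
  have L: "D f \<in> L2" "D s \<in> L2" "D ?r \<in> L2"
    using D N f s fs by (auto simp: bounded_operator_def)
  have "\<forall>a\<in>M. \<forall>b\<in>M. AE z in circle. D (\<lambda>w. a w + b w) z = D a z + D b z"
    using D by (simp add: bounded_operator_def)
  from bspec[OF bspec[OF this s] fs]
  have "AE z in circle. D (\<lambda>w. s w + ?r w) z = D s z + D ?r z" .
  then have "AE z in circle. D f z = D s z + D ?r z" by simp
  then have "AE z in circle. D f z * cnj (g z) = (D s z + D ?r z) * cnj (g z)"
    by eventually_elim simp
  then have "l2_inner (D f) g = l2_inner (\<lambda>z. D s z + D ?r z) g"
    using L g by (intro l2_inner_cong_AE) auto
  then have "l2_inner (D f) g - l2_inner (D s) g = l2_inner (D ?r) g"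
    using L g by (simp add: l2_inner_add_left)
  moreover have "cmod (l2_inner (D ?r) g) \<le> l2_norm (D ?r) * l2_norm g"
    using L g by (intro l2_Cauchy_Schwarz)
  moreover have "l2_norm (D ?r) * l2_norm g \<le> (C * l2_norm ?r) * l2_norm g"
    using bound[OF fs] by (intro mult_right_mono) auto
  ultimately show ?thesis by simp
qed

text \<open>
  On bounded functions both projections can be dropped, because \<open>g\<close> and its shift lie in the range
  space, and the two sides become the integrals of \<open>\<phi> * f * cnj g\<close> and of the same function
  multiplied by \<open>z * cnj z = 1\<close>.
\<close>

lemma Toeplitz_shift_bounded:
  assumes \<phi>: "\<phi> \<in> L2"
    and proj: "\<And>f. f \<in> K_perp \<theta> \<inter> Linf \<Longrightarrow> is_orth_proj (K_perp \<alpha>) (\<lambda>z. \<phi> z * f z) (D f)"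
    and s: "s \<in> K_perp \<theta> \<inter> Linf" and zs: "(\<lambda>z. z * s z) \<in> K_perp \<theta>"
    and g: "g \<in> K_perp \<alpha>" and zg: "(\<lambda>z. z * g z) \<in> K_perp \<alpha>"
  shows "l2_inner (D (\<lambda>z. z * s z)) (\<lambda>z. z * g z) = l2_inner (D s) g"
proof -
  have drop: "l2_inner (D f) h = l2_inner (\<lambda>z. \<phi> z * f z) h"
    if f: "f \<in> K_perp \<theta> \<inter> Linf" and h: "h \<in> K_perp \<alpha>" for f h
  proof -
    have "(\<lambda>z. f z * \<phi> z) \<in> L2" using f \<phi> by (intro Linf_mult_L2) auto
    then have "(\<lambda>z. \<phi> z * f z) \<in> L2" by (simp add: mult.commute)
    moreover have "D f \<in> K_perp \<alpha>" "l2_inner (\<lambda>z. \<phi> z * f z - D f z) h = 0"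
      using proj[OF f] h by (auto simp: is_orth_proj_def)
    ultimately show ?thesis
      using h K_perp_subset_L2 by (auto simp: l2_inner_diff_left subset_iff)
  qed
  have "(\<lambda>z. z * s z) \<in> K_perp \<theta> \<inter> Linf"
    using zs s by (auto intro!: Linf_mult)
  then have "l2_inner (D (\<lambda>z. z * s z)) (\<lambda>z. z * g z) = l2_inner (\<lambda>z. z * (\<phi> z * s z)) (\<lambda>z. z * g z)"
    using drop zg by (simp add: mult.left_commute)
  also have "\<dots> = l2_inner (D s) g"
    using drop[OF s g] by (simp add: l2_inner_shift)
  finally show ?thesis .
qed

lemma ADTTO_shift:
  assumes \<theta>: "inner_function \<theta>" and D: "ADTTO \<theta> \<alpha> D"
    and f: "f \<in> K_perp \<theta>" and orth: "l2_inner f (\<lambda>z. cnj z) = 0"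
    and g: "g \<in> K_perp \<alpha>" and zg: "(\<lambda>z. z * g z) \<in> K_perp \<alpha>"
  shows "l2_inner (D (\<lambda>z. z * f z)) (\<lambda>z. z * g z) = l2_inner (D f) g"
proof -
  obtain \<phi> where \<phi>: "\<phi> \<in> L2"
    and proj: "\<And>f. f \<in> K_perp \<theta> \<inter> Linf \<Longrightarrow> is_orth_proj (K_perp \<alpha>) (\<lambda>z. \<phi> z * f z) (D f)"
    using D by (auto simp: ADTTO_def)
  have op: "bounded_operator (K_perp \<theta>) (K_perp \<alpha>) D"
    using D by (simp add: ADTTO_def)
  then obtain C0 where "\<And>f. f \<in> K_perp \<theta> \<Longrightarrow> l2_norm (D f) \<le> C0 * l2_norm f"
    unfolding bounded_operator_def by blast
  moreover define C where "C = \<bar>C0\<bar>"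
  moreover have "C0 * l2_norm f \<le> C * l2_norm f" for f
    unfolding C_def by (intro mult_right_mono) auto
  ultimately have bound: "\<And>f. f \<in> K_perp \<theta> \<Longrightarrow> l2_norm (D f) \<le> C * l2_norm f"
    using order.trans by blast
  have gL: "g \<in> L2" using g K_perp_subset_L2 by blast
  define B where "B = 2 * C * l2_norm g"
  have B: "B \<ge> 0" by (simp add: B_def C_def)
  have "cmod (l2_inner (D (\<lambda>z. z * f z)) (\<lambda>z. z * g z) - l2_inner (D f) g) \<le> 0"
  proof (rule field_le_epsilon)
    fix e :: real assume e: "e > 0"
    obtain s where s: "s \<in> K_perp \<theta> \<inter> Linf" and s_orth: "l2_inner s (\<lambda>z. cnj z) = 0"
      and close: "l2_norm (\<lambda>z. f z - s z) < e / (B + 1)"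
      using bounded_dense_in_K_perp_orthogonal[OF \<theta> f orth, of "e / (B + 1)"] e B by auto
    have zf: "(\<lambda>z. z * f z) \<in> K_perp \<theta>" and zs: "(\<lambda>z. z * s z) \<in> K_perp \<theta>"
      using shift_mem_K_perp[OF \<theta>] f orth s s_orth by auto
    have diff: "(\<lambda>z. f z - s z) \<in> K_perp \<theta>" "(\<lambda>z. z * f z - z * s z) \<in> K_perp \<theta>"
      using f s zf zs by (auto intro!: K_perp_diff)
    have "l2_norm (\<lambda>z. z * f z - z * s z) = l2_norm (\<lambda>z. f z - s z)"
      using l2_norm_shift[of "\<lambda>z. f z - s z"] by (simp add: algebra_simps)
    then have "cmod (l2_inner (D (\<lambda>z. z * f z)) (\<lambda>z. z * g z) - l2_inner (D (\<lambda>z. z * s z)) (\<lambda>z. z * g z))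
        \<le> C * l2_norm (\<lambda>z. f z - s z) * l2_norm g"
      using bounded_operator_inner_diff_le[OF op K_perp_subset_L2 bound zf zs diff(2) L2_shift[OF gL]]
      by (simp add: l2_norm_shift)
    moreover have "cmod (l2_inner (D f) g - l2_inner (D s) g) \<le> C * l2_norm (\<lambda>z. f z - s z) * l2_norm g"
      using bounded_operator_inner_diff_le[OF op K_perp_subset_L2 bound f _ diff(1) gL] s by auto
    moreover have "l2_inner (D (\<lambda>z. z * s z)) (\<lambda>z. z * g z) = l2_inner (D s) g"
      by (rule Toeplitz_shift_bounded[OF \<phi> proj s zs g zg])
    ultimately have "cmod (l2_inner (D (\<lambda>z. z * f z)) (\<lambda>z. z * g z) - l2_inner (D f) g)
        \<le> 2 * (C * l2_norm (\<lambda>z. f z - s z) * l2_norm g)"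
      using norm_triangle_ineq4[of "l2_inner (D (\<lambda>z. z * f z)) (\<lambda>z. z * g z) - l2_inner (D s) g"
          "l2_inner (D f) g - l2_inner (D s) g"] by simp
    also have "\<dots> = B * l2_norm (\<lambda>z. f z - s z)" by (simp add: B_def)
    also have "\<dots> \<le> (B + 1) * (e / (B + 1))"
      using close B by (intro mult_mono) auto
    also have "\<dots> = 0 + e" using B by simp
    finally show "cmod (l2_inner (D (\<lambda>z. z * f z)) (\<lambda>z. z * g z) - l2_inner (D f) g) \<le> 0 + e" .
  qed
  then show ?thesis by simp
qed

text \<open>
  Shift invariance assumes that the shifts of \<open>f\<close> and \<open>g\<close> stay in the complements, the second
  claim that both are orthogonal to \<open>cnj z\<close>. Each of these implies what is needed above:
  orthogonality for \<open>f\<close>, membership of the shift for \<open>g\<close>.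
\<close>

theorem corollary4p4:
  fixes \<alpha> \<theta> :: "complex \<Rightarrow> complex"
    and D :: "(complex \<Rightarrow> complex) \<Rightarrow> (complex \<Rightarrow> complex)"
  assumes "inner_function \<alpha>" and "nonconstant \<alpha>"
    and "inner_function \<theta>" and "nonconstant \<theta>"
    and "bounded_operator (K_perp \<theta>) (K_perp \<alpha>) D"
    and "ADTTO \<theta> \<alpha> D"
  shows "shift_invariant (K_perp \<theta>) (K_perp \<alpha>) D \<and>
    (\<forall>f \<in> K_perp \<theta>. \<forall>g \<in> K_perp \<alpha>.
       l2_inner f (\<lambda>z. cnj z) = 0 \<longrightarrow> l2_inner g (\<lambda>z. cnj z) = 0 \<longrightarrow>
       l2_inner (D (\<lambda>z. z * f z)) (\<lambda>z. z * g z) = l2_inner (D f) g)"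
  unfolding shift_invariant_def
  using ADTTO_shift[OF assms(3,6)] shift_mem_K_perp[OF assms(1)]
    shift_mem_K_perp_imp_orthogonal[OF assms(3,4)]
  by blast

end
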